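(* Let $\mathbb{F}$ be a field of characteristic $0$, let $\mathcal{A}$ be a Lie conformal algebra over $\mathbb{F}$ that is free as an $\mathbb{F}[\partial]$-module and contains a Virasoro element $L$, and let $M$ be an $\mathcal{A}$-module that is free as an $\mathbb{F}[\partial]$-module and conformal with respect to $L$. Then for every $q\ge 1$, $$\dim \mathrm{H}^q(\mathcal{A},M)=\dim\widetilde{\mathrm{H}}^q(\mathcal{A},M)+\dim\widetilde{\mathrm{H}}^{q+1}(\mathcal{A},M),$$ where $\widetilde{\mathrm{H}}^\bullet$ and $\mathrm{H}^\bullet$ denote the basic and the reduced cohomology, respectively.
   Context: Lie conformal algebra (LCA): an $\mathbb{F}[\partial]$-module $\mathcal{A}$ with an $\mathbb{F}$-bilinear $\lambda$-bracket $\mathcal{A}\otimes\mathcal{A}\to\mathcal{A}[\lambda]$, $a\otimes b\mapsto[a_\lambda b]$, such that $[\partial a_\lambda b]=-\lambda[a_\lambda b]$, $[a_\lambda\partial b]=(\partial+\lambda)[a_\lambda b]$, $[a_\lambda b]=-[b_{-\lambda-\partial}a]$, and $[a_\lambda[b_\mu c]]=[[a_\lambda b]_{\lambda+\mu}c]+[b_\mu[a_\lambda c]]$. An $\mathcal{A}$-module is an $\mathbb{F}[\partial]$-module $M$ with an $\mathbb{F}$-bilinear $\lambda$-action $\mathcal{A}\otimes M\to M[\lambda]$, $a\otimes m\mapsto a_\lambda m$, such that $(\partial a)_\lambda m=-\lambda a_\lambda m$, $a_\lambda(\partial m)=(\partial+\lambda)a_\lambda m$, $a_\lambda(b_\mu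 m)-b_\mu(a_\lambda m)=[a_\lambda b]_{\lambda+\mu}m$. Write $\partial^M$ for the action of $\partial$ on $M$. Basic complex: for $q\ge 1$, $\widetilde{C}^q(\mathcal{A},M)$ is the space of $\mathbb{F}$-linear maps $f:\mathcal{A}^{\otimes q}\to M[\lambda_1,\dots,\lambda_q]$, $a_1\otimes\cdots\otimes a_q\mapsto f_{\lambda_1,\dots,\lambda_q}(a_1,\dots,a_q)$, with $f_{\lambda_1,\dots,\lambda_q}(a_1,\dots,\partial a_i,\dots,a_q)=-\lambda_i f_{\lambda_1,\dots,\lambda_q}(a_1,\dots,a_q)$ for all $i$, and skew-symmetric under simultaneous permutations of the $a_i$ and the $\lambda_i$. Also $\widetilde{C}^0(\mathcal{A},M)=M$. The differential is $$(\mathbf{d}f)_{\lambda_1,\dots,\lambda_{q+1}}(a_1,\dots,a_{q+1})=\sum_{k}(-1)^{k+1}a_{k\,\lambda_k}f_{\lambda_1,\dots,\hat\lambda_k,\dots,\lambda_{q+1}}(a_1,\dots,\hat a_k,\dots,a_{q+1})+\sum_{k<l}(-1)^{k+l}f_{\lambda_k+\lambda_l,\lambda_1,\dots,\hat\lambda_k,\dots,\hat\lambda_l,\dots,\lambda_{q+1}}([a_{k\,\lambda_k}a_l],a_1,\dots,\hat a_k,\dots,\hat a_l,\dots,a_{q+1}),$$ with $(\mathbf{d}m)_\lambda(a)=a_\lambda m$ for $m\in M$; hats denote omission, and polynomial coefficients in the $\lambda$'s are extended linearly. One has $\mathbf{d}^2=0$. Define $(\partial f)_{\lambda_1,\dots,\lambda_q}(a_1,\dots,a_q)=(\partial^M+\sum_{k=1}^q\lambda_k)f_{\lambda_1,\dots,\lambda_q}(a_1,\dots,a_q)$;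 then $\mathbf{d}\partial=\partial\mathbf{d}$, so $\partial\widetilde{C}^\bullet$ is a subcomplex. The reduced complex is $C^\bullet(\mathcal{A},M)=\widetilde{C}^\bullet(\mathcal{A},M)/\partial\widetilde{C}^\bullet(\mathcal{A},M)$. The basic cohomology $\widetilde{\mathrm{H}}^\bullet(\mathcal{A},M)$ is the cohomology of $\widetilde{C}^\bullet(\mathcal{A},M)$; the reduced cohomology $\mathrm{H}^\bullet(\mathcal{A},M)$ is the cohomology of $C^\bullet(\mathcal{A},M)$. Dimensions are over $\mathbb{F}$. A Virasoro element is $L\in\mathcal{A}$ with $[L_\lambda L]=(\partial+2\lambda)L$, $[L_\lambda\,\cdot\,]|_{\lambda=0}=\partial$ on $\mathcal{A}$, and $L_{(1)}:=\frac{d}{d\lambda}[L_\lambda\,\cdot\,]|_{\lambda=0}$ diagonalizable on $\mathcal{A}$. $M$ is conformal with respect to $L$ if $(L_\lambda\,\cdot\,)|_{\lambda=0}=\partial^M$ and $L^M_{(1)}:=\frac{d}{d\lambda}(L_\lambda\,\cdot\,)|_{\lambda=0}$ is diagonalizable on $M$. Standing convention: $\mathcal{A}$ and $M$ have $\mathbb{F}[\partial]$-bases consisting of eigenvectors of $L_{(1)}$ and $L^M_{(1)}$ respectively. *)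

theory Defs
  imports
    "HOL-Computational_Algebra.Polynomial"
    "HOL-Library.Poly_Mapping"
    "HOL-Combinatorics.Permutations"
begin

unbundle cardinal_syntax

section \<open>Polynomials in the $\lambda$'s with coefficients in an $\mathbb{F}[\partial]$-module\<close>

text \<open>
  An $\mathbb{F}[\partial]$-module is a \<^locale>\<open>module\<close> over \<^typ>\<open>'f poly\<close>; the
  indeterminate of \<^typ>\<open>'f poly\<close> is $\partial$.  If \<open>M\<close> is such a module on the type
  \<open>'m\<close>, then \<open>'m lpoly\<close> is $M[\lambda_0,\lambda_1,\dots]$, a module over
  $\mathbb{F}[\partial][\lambda_0,\lambda_1,\dots]$, which is the type \<open>'f poly lpoly\<close>.
  Indices of variables and of arguments start from 0.
\<close>

type_synonym 'm lpoly = "(nat \<Rightarrow>\<^sub>0 nat) \<Rightarrow>\<^sub>0 'm"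

abbreviation del :: "'f::comm_ring_1 poly" where "del \<equiv> [:0, 1:]"

definition Lam :: "nat \<Rightarrow> 'f::comm_ring_1 poly lpoly"
  where "Lam i = Poly_Mapping.single (Poly_Mapping.single i 1) 1"

definition Del :: "'f::comm_ring_1 poly lpoly"
  where "Del = Poly_Mapping.single 0 del"

definition const :: "'m::zero \<Rightarrow> 'm lpoly"
  where "const m = Poly_Mapping.single 0 m"

definition lscale :: "('f::comm_ring_1 poly \<Rightarrow> 'm::ab_group_add \<Rightarrow> 'm)
    \<Rightarrow> 'f poly lpoly \<Rightarrow> 'm lpoly \<Rightarrow> 'm lpoly"
  where "lscale s r p = (\<Sum>u\<in>Poly_Mapping.keys r. \<Sum>t\<in>Poly_Mapping.keys p.
    Poly_Mapping.single (u + t) (s (Poly_Mapping.lookup r u) (Poly_Mapping.lookup p t)))"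

text \<open>
  Substitution of the ring element \<open>r\<close>, which may involve $\partial$, for the variable of a
  polynomial in one variable; $\partial$ acts on the coefficients.
\<close>
definition at_lam :: "('f::comm_ring_1 poly \<Rightarrow> 'm::ab_group_add \<Rightarrow> 'm)
    \<Rightarrow> 'f poly lpoly \<Rightarrow> 'm poly \<Rightarrow> 'm lpoly"
  where "at_lam s r p = (\<Sum>n\<le>degree p. lscale s (r ^ n) (const (coeff p n)))"

text \<open>Substitution of \<open>rs ! i\<close> for $\lambda_i$.\<close>
definition at_lams :: "('f::comm_ring_1 poly \<Rightarrow> 'm::ab_group_add \<Rightarrow> 'm)
    \<Rightarrow> 'f poly lpoly list \<Rightarrow> 'm lpoly \<Rightarrow> 'm lpoly"
  where "at_lams s rs p = (\<Sum>t\<in>Poly_Mapping.keys p.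
    lscale s (\<Prod>i\<in>Poly_Mapping.keys t. (rs ! i) ^ Poly_Mapping.lookup t i)
      (const (Poly_Mapping.lookup p t)))"

text \<open>Linear extension of \<open>F\<close> to polynomial arguments: $\sum_t \lambda^t x_t$ is sent to
  $\sum_t \lambda^t F(x_t)$.\<close>
definition lextend :: "('f::comm_ring_1 poly \<Rightarrow> 'm::ab_group_add \<Rightarrow> 'm)
    \<Rightarrow> ('x::zero \<Rightarrow> 'm lpoly) \<Rightarrow> 'x lpoly \<Rightarrow> 'm lpoly"
  where "lextend s F p = (\<Sum>t\<in>Poly_Mapping.keys p.
    lscale s (Poly_Mapping.single t 1) (F (Poly_Mapping.lookup p t)))"

section \<open>Lie conformal algebras and their modules\<close>

locale lie_conformal_algebra = module sA
  for sA :: "'f::field poly \<Rightarrow> 'a::ab_group_add \<Rightarrow> 'a" +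
  fixes br :: "'a \<Rightarrow> 'a \<Rightarrow> 'a poly"
  assumes br_add_left: "br (a + b) c = br a c + br b c"
    and br_add_right: "br a (b + c) = br a b + br a c"
    and br_scale_left: "br (sA [:k:] a) b = map_poly (sA [:k:]) (br a b)"
    and br_scale_right: "br a (sA [:k:] b) = map_poly (sA [:k:]) (br a b)"
    and br_del_left:
      "at_lam sA (Lam 0) (br (sA del a) b) = lscale sA (- Lam 0) (at_lam sA (Lam 0) (br a b))"
    and br_del_right:
      "at_lam sA (Lam 0) (br a (sA del b)) = lscale sA (Del + Lam 0) (at_lam sA (Lam 0) (br a b))"
    and br_skew: "at_lam sA (Lam 0) (br a b) = - at_lam sA (- Lam 0 - Del) (br b a)"
    and br_jacobi:
      "lextend sA (\<lambda>x. at_lam sA (Lam 0) (br a x)) (at_lam sA (Lam 1) (br b c))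
       = lextend sA (\<lambda>x. at_lam sA (Lam 0 + Lam 1) (br x c)) (at_lam sA (Lam 0) (br a b))
       + lextend sA (\<lambda>x. at_lam sA (Lam 1) (br b x)) (at_lam sA (Lam 0) (br a c))"

locale lca_module = lie_conformal_algebra sA br + M: module sM
  for sA :: "'f::field poly \<Rightarrow> 'a::ab_group_add \<Rightarrow> 'a"
    and br :: "'a \<Rightarrow> 'a \<Rightarrow> 'a poly"
    and sM :: "'f poly \<Rightarrow> 'm::ab_group_add \<Rightarrow> 'm" +
  fixes act :: "'a \<Rightarrow> 'm \<Rightarrow> 'm poly"
  assumes act_add_left: "act (a + b) m = act a m + act b m"
    and act_add_right: "act a (m + n) = act a m + act a n"
    and act_scale_left: "act (sA [:k:] a) m = map_poly (sM [:k:]) (act a m)"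
    and act_scale_right: "act a (sM [:k:] m) = map_poly (sM [:k:]) (act a m)"
    and act_del_left:
      "at_lam sM (Lam 0) (act (sA del a) m) = lscale sM (- Lam 0) (at_lam sM (Lam 0) (act a m))"
    and act_del_right:
      "at_lam sM (Lam 0) (act a (sM del m)) = lscale sM (Del + Lam 0) (at_lam sM (Lam 0) (act a m))"
    and act_br:
      "lextend sM (\<lambda>n. at_lam sM (Lam 0) (act a n)) (at_lam sM (Lam 1) (act b m))
       - lextend sM (\<lambda>n. at_lam sM (Lam 1) (act b n)) (at_lam sM (Lam 0) (act a m))
       = lextend sM (\<lambda>x. at_lam sM (Lam 0 + Lam 1) (act x m)) (at_lam sA (Lam 0) (br a b))"

definition is_basis :: "('r::comm_ring_1 \<Rightarrow> 'v::ab_group_add \<Rightarrow> 'v) \<Rightarrow> 'v set \<Rightarrow> bool"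
  where "is_basis s B \<longleftrightarrow> \<not> module.dependent s B \<and> module.span s B = UNIV"

definition is_free :: "('r::comm_ring_1 \<Rightarrow> 'v::ab_group_add \<Rightarrow> 'v) \<Rightarrow> bool"
  where "is_free s \<longleftrightarrow> (\<exists>B. is_basis s B)"

definition diagonalizable :: "('f::field \<Rightarrow> 'v::ab_group_add \<Rightarrow> 'v) \<Rightarrow> ('v \<Rightarrow> 'v) \<Rightarrow> bool"
  where "diagonalizable s T \<longleftrightarrow> (\<exists>B. is_basis s B \<and> (\<forall>b\<in>B. \<exists>c. T b = s c b))"

definition virasoro_element :: "('f::field poly \<Rightarrow> 'a::ab_group_add \<Rightarrow> 'a)
    \<Rightarrow> ('a \<Rightarrow> 'a \<Rightarrow> 'a poly) \<Rightarrow> 'a \<Rightarrow> bool"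
  where "virasoro_element sA br L \<longleftrightarrow>
    at_lam sA (Lam 0) (br L L) = lscale sA (Del + 2 * Lam 0) (const L) \<and>
    (\<forall>a. coeff (br L a) 0 = sA del a) \<and>
    diagonalizable (\<lambda>k. sA [:k:]) (\<lambda>a. coeff (br L a) 1)"

definition conformal_module :: "('f::field poly \<Rightarrow> 'm::ab_group_add \<Rightarrow> 'm)
    \<Rightarrow> ('a \<Rightarrow> 'm \<Rightarrow> 'm poly) \<Rightarrow> 'a \<Rightarrow> bool"
  where "conformal_module sM act L \<longleftrightarrow>
    (\<forall>m. coeff (act L m) 0 = sM del m) \<and>
    diagonalizable (\<lambda>k. sM [:k:]) (\<lambda>m. coeff (act L m) 1)"

definition has_eigenbasis :: "('f::field poly \<Rightarrow> 'v::ab_group_add \<Rightarrow> 'v) \<Rightarrow> ('v \<Rightarrow> 'v) \<Rightarrow> bool"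
  where "has_eigenbasis s T \<longleftrightarrow> (\<exists>B. is_basis s B \<and> (\<forall>b\<in>B. \<exists>c. T b = s [:c:] b))"

section \<open>Vector spaces with explicit carrier, quotients, dimension, cohomology\<close>

text \<open>Quotients of quotients are needed, so the carriers cannot be types.\<close>

record ('f, 'v) vspace =
  carr :: "'v set"
  vzero :: 'v
  vadd :: "'v \<Rightarrow> 'v \<Rightarrow> 'v"
  vscale :: "'f \<Rightarrow> 'v \<Rightarrow> 'v"

definition vsubspace :: "('f, 'v) vspace \<Rightarrow> 'v set \<Rightarrow> bool"
  where "vsubspace V U \<longleftrightarrow> U \<subseteq> carr V \<and> vzero V \<in> U \<and>
    (\<forall>x\<in>U. \<forall>y\<in>U. vadd V x y \<in> U) \<and> (\<forall>c. \<forall>x\<in>U. vscale V c x \<in> U)"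

definition vspan :: "('f, 'v) vspace \<Rightarrow> 'v set \<Rightarrow> 'v set"
  where "vspan V S = \<Inter>{U. vsubspace V U \<and> S \<subseteq> U}"

definition vbasis :: "('f, 'v) vspace \<Rightarrow> 'v set \<Rightarrow> bool"
  where "vbasis V B \<longleftrightarrow> B \<subseteq> carr V \<and> (\<forall>b\<in>B. b \<notin> vspan V (B - {b})) \<and> vspan V B = carr V"

text \<open>The dimension is a cardinal, so infinite dimensions are distinguished by their size.\<close>
definition vdim :: "('f, 'v) vspace \<Rightarrow> 'v rel"
  where "vdim V = |SOME B. vbasis V B|"

definition coset :: "('f, 'v) vspace \<Rightarrow> 'v set \<Rightarrow> 'v \<Rightarrow> 'v set"
  where "coset V U x = (\<lambda>u. vadd V x u) ` U"

definition quot :: "('f, 'v) vspace \<Rightarrow> 'v set \<Rightarrow> ('f, 'v set) vspace"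
  where "quot V U = \<lparr>carr = coset V U ` carr V, vzero = U,
    vadd = (\<lambda>X Y. \<Union>x\<in>X. \<Union>y\<in>Y. coset V U (vadd V x y)),
    vscale = (\<lambda>c X. \<Union>x\<in>X. coset V U (vscale V c x))\<rparr>"

definition quot_map :: "('f, 'w) vspace \<Rightarrow> 'w set \<Rightarrow> ('v \<Rightarrow> 'w) \<Rightarrow> 'v set \<Rightarrow> 'w set"
  where "quot_map W U T X = (\<Union>x\<in>X. coset W U (T x))"

definition cohomology :: "(nat \<Rightarrow> ('f, 'v) vspace) \<Rightarrow> (nat \<Rightarrow> 'v \<Rightarrow> 'v) \<Rightarrow> nat
    \<Rightarrow> ('f, 'v set) vspace"
  where "cohomology V d q =
    quot ((V q)\<lparr>carr := {x \<in> carr (V q). d q x = vzero (V (Suc q))}\<rparr>)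
      (case q of 0 \<Rightarrow> {vzero (V 0)} | Suc p \<Rightarrow> d p ` carr (V p))"

section \<open>The basic and the reduced complex\<close>

text \<open>
  A \<open>q\<close>-cochain is a function of lists of length \<open>q\<close>, set to 0 on other lists.  For
  \<open>q = 0\<close> it is determined by its value on the empty list, a polynomial in no variables, i.e.
  an element of \<open>M\<close>.
\<close>

type_synonym ('a, 'm) cochain = "'a list \<Rightarrow> 'm lpoly"

definition lams :: "nat \<Rightarrow> 'f::comm_ring_1 poly lpoly list"
  where "lams q = map Lam [0..<q]"

definition cochains :: "('f::field poly \<Rightarrow> 'a::ab_group_add \<Rightarrow> 'a)
    \<Rightarrow> ('f poly \<Rightarrow> 'm::ab_group_add \<Rightarrow> 'm) \<Rightarrow> nat \<Rightarrow> ('a, 'm) cochain set"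
  where "cochains sA sM q = {f.
    (\<forall>as. length as \<noteq> q \<longrightarrow> f as = 0) \<and>
    (\<forall>as. length as = q \<longrightarrow>
      (\<forall>t\<in>Poly_Mapping.keys (f as). Poly_Mapping.keys t \<subseteq> {..<q}) \<and>
      (\<forall>i<q. \<forall>x y. f (as[i := x + y]) = f (as[i := x]) + f (as[i := y])) \<and>
      (\<forall>i<q. \<forall>k x. f (as[i := sA [:k:] x]) = lscale sM (const [:k:]) (f (as[i := x]))) \<and>
      (\<forall>i<q. f (as[i := sA del (as ! i)]) = lscale sM (- Lam i) (f as)) \<and>
      (\<forall>\<pi>. \<pi> permutes {..<q} \<longrightarrow>
        at_lams sM (permute_list \<pi> (lams q)) (f (permute_list \<pi> as))
          = lscale sM (of_int (sign \<pi>)) (f as)))}"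

definition basic_space :: "('f::field poly \<Rightarrow> 'a::ab_group_add \<Rightarrow> 'a)
    \<Rightarrow> ('f poly \<Rightarrow> 'm::ab_group_add \<Rightarrow> 'm) \<Rightarrow> nat \<Rightarrow> ('f, ('a, 'm) cochain) vspace"
  where "basic_space sA sM q = \<lparr>carr = cochains sA sM q, vzero = (\<lambda>as. 0),
    vadd = (\<lambda>f g as. f as + g as),
    vscale = (\<lambda>k f as. lscale sM (const [:k:]) (f as))\<rparr>"

text \<open>With arguments numbered from 0 the signs $(-1)^{k+1}$ and $(-1)^{k+l}$ become
  $(-1)^k$ and $(-1)^{k+l}$.\<close>
definition diff :: "('f::field poly \<Rightarrow> 'a::ab_group_add \<Rightarrow> 'a) \<Rightarrow> ('a \<Rightarrow> 'a \<Rightarrow> 'a poly)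
    \<Rightarrow> ('f poly \<Rightarrow> 'm::ab_group_add \<Rightarrow> 'm) \<Rightarrow> ('a \<Rightarrow> 'm \<Rightarrow> 'm poly)
    \<Rightarrow> nat \<Rightarrow> ('a, 'm) cochain \<Rightarrow> ('a, 'm) cochain"
  where "diff sA br sM act q f as = (if length as \<noteq> Suc q then 0 else
    (\<Sum>k<Suc q. lscale sM ((- 1) ^ k)
      (lextend sM (\<lambda>m. at_lam sM (Lam k) (act (as ! k) m))
        (at_lams sM (nths (lams (Suc q)) (- {k})) (f (nths as (- {k}))))))
    + (\<Sum>l<Suc q. \<Sum>k<l. lscale sM ((- 1) ^ (k + l))
        (lextend sM
          (\<lambda>x. at_lams sM ((Lam k + Lam l) # nths (lams (Suc q)) (- {k, l}))
            (f (x # nths as (- {k, l}))))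
          (at_lam sA (Lam k) (br (as ! k) (as ! l))))))"

definition del_cochain :: "('f::field poly \<Rightarrow> 'm::ab_group_add \<Rightarrow> 'm)
    \<Rightarrow> nat \<Rightarrow> ('a, 'm) cochain \<Rightarrow> ('a, 'm) cochain"
  where "del_cochain sM q f as = lscale sM (Del + (\<Sum>k<q. Lam k)) (f as)"

definition del_image :: "('f::field poly \<Rightarrow> 'a::ab_group_add \<Rightarrow> 'a)
    \<Rightarrow> ('f poly \<Rightarrow> 'm::ab_group_add \<Rightarrow> 'm) \<Rightarrow> nat \<Rightarrow> ('a, 'm) cochain set"
  where "del_image sA sM q = del_cochain sM q ` cochains sA sM q"

definition reduced_space :: "('f::field poly \<Rightarrow> 'a::ab_group_add \<Rightarrow> 'a)
    \<Rightarrow> ('f poly \<Rightarrow> 'm::ab_group_add \<Rightarrow> 'm) \<Rightarrow> nat \<Rightarrow> ('f, ('a, 'm) cochain set) vspace"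
  where "reduced_space sA sM q = quot (basic_space sA sM q) (del_image sA sM q)"

definition reduced_diff :: "('f::field poly \<Rightarrow> 'a::ab_group_add \<Rightarrow> 'a)
    \<Rightarrow> ('a \<Rightarrow> 'a \<Rightarrow> 'a poly) \<Rightarrow> ('f poly \<Rightarrow> 'm::ab_group_add \<Rightarrow> 'm)
    \<Rightarrow> ('a \<Rightarrow> 'm \<Rightarrow> 'm poly) \<Rightarrow> nat \<Rightarrow> ('a, 'm) cochain set \<Rightarrow> ('a, 'm) cochain set"
  where "reduced_diff sA br sM act q =
    quot_map (basic_space sA sM (Suc q)) (del_image sA sM (Suc q)) (diff sA br sM act q)"

definition basic_cohomology :: "('f::field poly \<Rightarrow> 'a::ab_group_add \<Rightarrow> 'a)
    \<Rightarrow> ('a \<Rightarrow> 'a \<Rightarrow> 'a poly) \<Rightarrow> ('f poly \<Rightarrow> 'm::ab_group_add \<Rightarrow> 'm)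
    \<Rightarrow> ('a \<Rightarrow> 'm \<Rightarrow> 'm poly) \<Rightarrow> nat \<Rightarrow> ('f, ('a, 'm) cochain set) vspace"
  where "basic_cohomology sA br sM act = cohomology (basic_space sA sM) (diff sA br sM act)"

definition reduced_cohomology :: "('f::field poly \<Rightarrow> 'a::ab_group_add \<Rightarrow> 'a)
    \<Rightarrow> ('a \<Rightarrow> 'a \<Rightarrow> 'a poly) \<Rightarrow> ('f poly \<Rightarrow> 'm::ab_group_add \<Rightarrow> 'm)
    \<Rightarrow> ('a \<Rightarrow> 'm \<Rightarrow> 'm poly) \<Rightarrow> nat \<Rightarrow> ('f, ('a, 'm) cochain set set) vspace"
  where "reduced_cohomology sA br sM act =
    cohomology (reduced_space sA sM) (reduced_diff sA br sM act)"

end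

theory Submission
  imports Defs "HOL-Library.Product_Plus" "HOL-Library.Function_Algebras"
begin

text \<open>
  The action of \<open>\<partial>\<close> on the basic complex is null-homotopic.  The homotopy is the contraction with
  the Virasoro element \<open>L\<close> at \<open>\<lambda> = 0\<close>: by Cartan's formula its anticommutator with the differential
  is the Lie derivative along \<open>L\<close> at \<open>\<lambda> = 0\<close>.  This is \<open>\<partial>\<close> on the values minus the sum of \<open>\<partial>\<close> on all
  arguments, since \<open>L\<close> at \<open>\<lambda> = 0\<close> acts by \<open>\<partial>\<close> on the algebra and on the module; and
  \<open>\<partial>\<close> on the \<open>k\<close>-th argument is \<open>- \<lambda>\<^sub>k\<close>, so the result is the operator \<open>\<partial> + \<Sum> \<lambda>\<^sub>k\<close>.  This operator is
  injective, because the module is free.  Hence the image of \<open>\<partial>\<close> is a subcomplex isomorphic to the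
  basic complex, whose inclusion induces the zero map on cohomology in positive degrees, and the
  long exact sequence of the quotient breaks up into short exact sequences
  \<open>0 \<rightarrow> H\<^sup>q(basic) \<rightarrow> H\<^sup>q(reduced) \<rightarrow> H\<^sup>q\<^sup>+\<^sup>1(basic) \<rightarrow> 0\<close>.  The lemma \<open>vdim_reduced\<close> carries
  out this argument for any complex with an injective null-homotopic endomorphism, and splits the
  sequence explicitly by the homotopy.

  What has to be known about the basic complex, namely that the differential preserves cochains,
  has square 0, commutes with \<open>\<partial>\<close> and satisfies Cartan's formula, is proved by giving values in the
  field to the variables \<open>\<lambda>\<^sub>i\<close>.  In characteristic 0 a polynomial is determined by its values
  (\<open>ev_eqI\<close>).  An element of the algebra together with a value \<open>c\<close> of its variable behaves like an element of
  degree \<open>c\<close> of a graded Lie algebra: the Jacobi identity and the module axiom lose their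
  variables, and \<open>\<partial>\<close> becomes the number \<open>- c\<close> under a cochain, so that \<open>[a\<^sub>\<lambda> b] = - [b a]\<close> at
  \<open>- \<lambda> - \<partial>\<close> becomes plain skew-symmetry.  Cochains correspond to alternating multilinear functions on lists of
  such pairs (\<open>cochains_Ev\<close>, \<open>cochainI\<close>), and the differential to that of Chevalley and Eilenberg
  (\<open>ev_diff\<close>), whose properties follow by induction on the list of arguments from a recursive form
  of Cartan's formula.
\<close>

section \<open>Quotients of vector spaces and their dimensions\<close>

text \<open>The parts of the vector space axioms that make cosets of a subspace behave.  Cosets of cosets
  occur below, so the axioms must be available for carriers inside an arbitrary type.\<close>
locale vec =
  fixes V :: "('f::field, 'v) vspace"
  assumes zero_closed: "vzero V \<in> carr V"
    and add_closed: "x \<in> carr V \<Longrightarrow> y \<in> carr V \<Longrightarrow> vadd V x y \<in> carr V"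
    and scale_closed: "x \<in> carr V \<Longrightarrow> vscale V c x \<in> carr V"
    and add_assoc: "x \<in> carr V \<Longrightarrow> y \<in> carr V \<Longrightarrow> z \<in> carr V \<Longrightarrow>
      vadd V (vadd V x y) z = vadd V x (vadd V y z)"
    and add_comm: "x \<in> carr V \<Longrightarrow> y \<in> carr V \<Longrightarrow> vadd V x y = vadd V y x"
    and add_zero: "x \<in> carr V \<Longrightarrow> vadd V x (vzero V) = x"
    and add_neg: "x \<in> carr V \<Longrightarrow> vadd V x (vscale V (- 1) x) = vzero V"
    and scale_add: "x \<in> carr V \<Longrightarrow> y \<in> carr V \<Longrightarrow>
      vscale V c (vadd V x y) = vadd V (vscale V c x) (vscale V c y)"

definition vlin :: "('f \<Rightarrow> 'e::ab_group_add \<Rightarrow> 'e) \<Rightarrow> ('f, 'v) vspace \<Rightarrow> ('v \<Rightarrow> 'e) \<Rightarrow> bool"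
  where "vlin s V g \<longleftrightarrow> (\<forall>x\<in>carr V. \<forall>y\<in>carr V. g (vadd V x y) = g x + g y) \<and>
    (\<forall>c. \<forall>x\<in>carr V. g (vscale V c x) = s c (g x))"

lemma vlin_add: "vlin s V g \<Longrightarrow> x \<in> carr V \<Longrightarrow> y \<in> carr V \<Longrightarrow> g (vadd V x y) = g x + g y"
  and vlin_scale: "vlin s V g \<Longrightarrow> x \<in> carr V \<Longrightarrow> g (vscale V c x) = s c (g x)"
  by (simp_all add: vlin_def)

context vec
begin

lemma add_left_commute:
  assumes "x \<in> carr V" "y \<in> carr V" "z \<in> carr V"
  shows "vadd V x (vadd V y z) = vadd V y (vadd V x z)"
  using add_assoc[OF assms(1,2,3)] add_assoc[OF assms(2,1,3)] add_comm[OF assms(1,2)] by simp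

lemma add_neg_cancel:
  assumes "x \<in> carr V" "y \<in> carr V"
  shows "vadd V (vadd V x y) (vscale V (- 1) y) = x"
  using assms by (simp add: add_assoc scale_closed add_neg add_zero)

lemma vsubspace_carr: "vsubspace V (carr V)"
  by (auto simp: vsubspace_def zero_closed add_closed scale_closed)

context
  fixes U assumes U: "vsubspace V U"
begin

lemma U_carr: "u \<in> U \<Longrightarrow> u \<in> carr V"
  and U_zero: "vzero V \<in> U"
  and U_add: "u \<in> U \<Longrightarrow> v \<in> U \<Longrightarrow> vadd V u v \<in> U"
  and U_scale: "u \<in> U \<Longrightarrow> vscale V c u \<in> U"
  using U by (auto simp: vsubspace_def)

lemma self_in_coset: "x \<in> carr V \<Longrightarrow> x \<in> coset V U x"
  unfolding coset_def using U_zero add_zero[of x] by force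

lemma coset_add_U:
  assumes x: "x \<in> carr V" and u: "u \<in> U" shows "coset V U (vadd V x u) = coset V U x"
proof
  show "coset V U (vadd V x u) \<subseteq> coset V U x"
    unfolding coset_def using x u by (auto simp: add_assoc U_carr intro: U_add)
  show "coset V U x \<subseteq> coset V U (vadd V x u)"
  proof
    fix y assume "y \<in> coset V U x"
    then obtain v where v: "v \<in> U" "y = vadd V x v" by (auto simp: coset_def)
    have "y = vadd V (vadd V x u) (vadd V (vscale V (- 1) u) v)"
      using x u v(1)
      by (simp add: v(2) U_carr add_closed scale_closed add_assoc[symmetric] add_neg_cancel)
    moreover have "vadd V (vscale V (- 1) u) v \<in> U" using u v by (simp add: U_add U_scale)
    ultimately show "y \<in> coset V U (vadd V x u)" by (auto simp: coset_def)
  qed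
qed

lemma coset_zero: "u \<in> U \<Longrightarrow> coset V U u = U"
proof -
  assume u: "u \<in> U"
  have "coset V U (vzero V) = U"
    unfolding coset_def using add_comm[OF zero_closed] add_zero U_carr zero_closed
    by (auto simp: image_iff)
  then show ?thesis
    using coset_add_U[OF zero_closed u] add_comm[OF zero_closed U_carr[OF u]] add_zero[OF U_carr[OF u]]
    by simp
qed

lemma quot_add:
  assumes "x \<in> carr V" "y \<in> carr V"
  shows "vadd (quot V U) (coset V U x) (coset V U y) = coset V U (vadd V x y)"
proof -
  have "coset V U (vadd V x' y') = coset V U (vadd V x y)"
    if x': "x' \<in> coset V U x" and y': "y' \<in> coset V U y" for x' y'
  proof -
    obtain u v where uv: "u \<in> U" "v \<in> U" "x' = vadd V x u" "y' = vadd V y v"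
      using x' y' by (auto simp: coset_def)
    have "vadd V x' y' = vadd V (vadd V x y) (vadd V u v)"
      using assms uv(1,2) by (simp add: uv(3,4) add_assoc add_closed U_carr add_left_commute)
    then show ?thesis using assms uv by (simp add: coset_add_U add_closed U_add)
  qed
  then have "vadd (quot V U) (coset V U x) (coset V U y)
    = (\<Union>x'\<in>coset V U x. \<Union>y'\<in>coset V U y. coset V U (vadd V x y))"
    unfolding quot_def vspace.simps by (intro SUP_cong refl)
  then show ?thesis
    using self_in_coset[OF assms(1)] self_in_coset[OF assms(2)] by auto
qed

lemma quot_scale:
  assumes "x \<in> carr V"
  shows "vscale (quot V U) c (coset V U x) = coset V U (vscale V c x)"
proof -
  have "coset V U (vscale V c x') = coset V U (vscale V c x)" if x': "x' \<in> coset V U x" for x'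
  proof -
    obtain u where u: "u \<in> U" "x' = vadd V x u"
      using x' by (auto simp: coset_def)
    then show ?thesis
      using assms by (simp add: scale_add U_carr coset_add_U scale_closed U_scale)
  qed
  then have "vscale (quot V U) c (coset V U x) = (\<Union>x'\<in>coset V U x. coset V U (vscale V c x))"
    unfolding quot_def vspace.simps by (intro SUP_cong refl)
  then show ?thesis
    using self_in_coset[OF assms] by auto
qed

lemma quot_zero: "vzero (quot V U) = coset V U (vzero V)"
  by (simp add: quot_def coset_zero U_zero)

lemma carr_quot: "carr (quot V U) = coset V U ` carr V"
  by (simp add: quot_def)

lemma vec_quot: "vec (quot V U)"
proof unfold_locales
  show "vadd (quot V U) X Y = vadd (quot V U) Y X"
    if "X \<in> carr (quot V U)" "Y \<in> carr (quot V U)" for X Y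
    using that by (auto simp: carr_quot quot_add add_comm)
qed (auto simp: carr_quot quot_zero quot_add quot_scale zero_closed add_closed scale_closed
      add_zero add_neg scale_add add_assoc)

text \<open>The choice of a representative is harmless, because \<open>g\<close> is constant on cosets.\<close>
lemma quot_lift:
  assumes g: "vlin s V g" and 0: "\<And>u. u \<in> U \<Longrightarrow> g u = 0" and x: "x \<in> carr V"
  shows "g (SOME y. y \<in> coset V U x) = g x"
proof -
  have "(SOME y. y \<in> coset V U x) \<in> coset V U x"
    using self_in_coset[OF x] by (rule someI)
  then obtain u where "u \<in> U" "(SOME y. y \<in> coset V U x) = vadd V x u"
    by (auto simp: coset_def)
  then show ?thesis using vlin_add[OF g x] 0 U_carr by simp
qed

lemma vlin_quot_lift:
  assumes g: "vlin s V g" and 0: "\<And>u. u \<in> U \<Longrightarrow> g u = 0"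
  shows "vlin s (quot V U) (\<lambda>X. g (SOME y. y \<in> X))"
  unfolding vlin_def
  by (auto simp: carr_quot quot_add quot_scale quot_lift[OF g 0] add_closed scale_closed
      vlin_add[OF g] vlin_scale[OF g])

end

text \<open>This is how dimensions are computed: a carrier that embeds linearly into a vector space which
  fills its type has the dimension of its image.  The invariance of the size of a basis, for
  infinite bases too, is thereby inherited from the type-based theory.\<close>
lemma vdim_eq:
  fixes s :: "'f \<Rightarrow> 'e::ab_group_add \<Rightarrow> 'e"
  assumes s: "vector_space s" and g: "vlin s V g"
    and ker: "\<And>x. x \<in> carr V \<Longrightarrow> g x = 0 \<Longrightarrow> x = vzero V"
    and T: "\<not> module.dependent s T" "module.span s T = g ` carr V"
  shows "vdim V =o |T|"
proof -
  interpret s: vector_space s by fact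
  have g0: "g (vzero V) = 0"
    using vlin_add[OF g zero_closed zero_closed] add_zero[OF zero_closed] by simp
  have inj: "inj_on g (carr V)"
  proof (rule inj_onI)
    fix x y assume xy: "x \<in> carr V" "y \<in> carr V" "g x = g y"
    have "g (vadd V x (vscale V (- 1) y)) = 0"
      using xy by (simp add: vlin_add[OF g] vlin_scale[OF g] scale_closed)
    then have "vadd V x (vscale V (- 1) y) = vadd V y (vscale V (- 1) y)"
      using ker xy by (simp add: add_closed scale_closed add_neg)
    then have "vadd V (vadd V x (vscale V (- 1) y)) y = vadd V (vadd V y (vscale V (- 1) y)) y"
      by simp
    then show "x = y"
      using xy by (simp add: add_assoc add_comm[of "vscale V (- 1) y" y] scale_closed add_neg add_zero
          add_comm[OF zero_closed])
  qed
  have span: "g ` vspan V S = s.span (g ` S)" if S: "S \<subseteq> carr V" for S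
  proof
    have "vsubspace V {x \<in> carr V. g x \<in> s.span (g ` S)}"
      by (auto simp: vsubspace_def zero_closed add_closed scale_closed g0 vlin_add[OF g]
          vlin_scale[OF g] s.span_zero s.span_add s.span_scale)
    then have "vspan V S \<subseteq> {x \<in> carr V. g x \<in> s.span (g ` S)}"
      unfolding vspan_def using S by (intro Inter_lower) (auto intro: s.span_base)
    then show "g ` vspan V S \<subseteq> s.span (g ` S)" by auto
    have c: "vspan V S \<subseteq> carr V"
      unfolding vspan_def using S vsubspace_carr by (intro Inter_lower) auto
    have vs: "vsubspace V (vspan V S)"
      using c unfolding vspan_def vsubspace_def by blast
    have "s.subspace (g ` vspan V S)"
    proof (rule s.subspaceI)
      show "0 \<in> g ` vspan V S"
        using vs g0 by (force simp: vsubspace_def)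
      fix x y c' assume "x \<in> g ` vspan V S"
      then obtain a where a: "a \<in> vspan V S" "x = g a" by auto
      have "vscale V c' a \<in> vspan V S" using vs a by (simp add: vsubspace_def)
      then show "s c' x \<in> g ` vspan V S"
        using a c vlin_scale[OF g, of a c'] by (metis image_eqI subsetD)
      assume "y \<in> g ` vspan V S"
      then obtain b where b: "b \<in> vspan V S" "y = g b" by auto
      have "vadd V a b \<in> vspan V S" using vs a b by (simp add: vsubspace_def)
      then show "x + y \<in> g ` vspan V S"
        using a b c vlin_add[OF g, of a b] by (metis image_eqI subsetD)
    qed
    moreover have "S \<subseteq> vspan V S" unfolding vspan_def by blast
    ultimately show "s.span (g ` S) \<subseteq> g ` vspan V S"
      by (intro s.span_minimal) auto
  qed
  have vspan_carr: "vspan V S \<subseteq> carr V" if "S \<subseteq> carr V" for S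
    unfolding vspan_def using that vsubspace_carr by (intro Inter_lower) auto
  have vspan_iff: "b \<in> vspan V (C - {b}) \<longleftrightarrow> g b \<in> s.span (g ` C - {g b})"
    if "C \<subseteq> carr V" "b \<in> C" for b C
  proof -
    have "g ` C - {g b} = g ` (C - {b})"
      using inj_on_image_set_diff[OF inj, of C "{b}"] that by auto
    then have "g ` vspan V (C - {b}) = s.span (g ` C - {g b})"
      using span[of "C - {b}"] that by auto
    moreover have "b \<in> vspan V (C - {b}) \<longleftrightarrow> g b \<in> g ` vspan V (C - {b})"
      using inj_on_image_mem_iff[OF inj, of b "vspan V (C - {b})"] vspan_carr[of "C - {b}"] that
      by blast
    ultimately show ?thesis by simp
  qed
  have basis_iff: "vbasis V C \<longleftrightarrow> s.independent (g ` C) \<and> s.span (g ` C) = g ` carr V"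
    if C: "C \<subseteq> carr V" for C
  proof -
    have "vspan V C = carr V \<longleftrightarrow> s.span (g ` C) = g ` carr V"
      using span[OF C] inj_on_image_eq_iff[OF inj vspan_carr[OF C] order_refl] by simp
    then show ?thesis
      unfolding vbasis_def s.dependent_def using C by (auto simp: vspan_iff)
  qed
  have T_carr: "T \<subseteq> g ` carr V" using T(2) s.span_superset by blast
  then obtain C where "C \<subseteq> carr V" "g ` C = T" by (metis subset_imageE)
  then have "\<exists>C. vbasis V C" using basis_iff T by auto
  then have b: "vbasis V (SOME C. vbasis V C)" by (rule someI_ex)
  define C where "C = (SOME C. vbasis V C)"
  have C: "C \<subseteq> carr V" "s.independent (g ` C)" "s.span (g ` C) = g ` carr V"
    using b basis_iff unfolding C_def vbasis_def by blast+
  obtain f where "bij_betw f (g ` C) T"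
    using s.bij_if_span_eq_span_bases[OF C(2) T(1)] C(3) T(2) by auto
  moreover have "bij_betw g C (g ` C)"
    using inj C(1) by (meson inj_on_imp_bij_betw inj_on_subset)
  ultimately show ?thesis
    unfolding vdim_def C_def[symmetric] by (meson bij_betw_trans card_of_ordIsoI)
qed

end

definition prod_scale :: "('f \<Rightarrow> 'e \<Rightarrow> 'e) \<Rightarrow> 'f \<Rightarrow> 'e \<times> 'e \<Rightarrow> 'e \<times> 'e"
  where "prod_scale s c z = (s c (fst z), s c (snd z))"

definition subspace_record :: "('f \<Rightarrow> 'e::ab_group_add \<Rightarrow> 'e) \<Rightarrow> 'e set \<Rightarrow> ('f, 'e) vspace"
  where "subspace_record s A = \<lparr>carr = A, vzero = 0, vadd = (+), vscale = s\<rparr>"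

lemma subspace_record_simps [simp]:
  "carr (subspace_record s A) = A" "vzero (subspace_record s A) = 0" "vadd (subspace_record s A) = (+)" "vscale (subspace_record s A) = s"
  "subspace_record s A\<lparr>carr := A'\<rparr> = subspace_record s A'"
  by (simp_all add: subspace_record_def)

lemma coset_subspace_record: "coset (subspace_record s A) U x = (+) x ` U"
  by (simp add: coset_def)

context vector_space
begin

lemma vec_subspace_record: "subspace A \<Longrightarrow> vec (subspace_record scale A)"
  by unfold_locales
    (auto simp: subspace_0 subspace_add subspace_scale scale_right_distrib)

lemma vsubspace_subspace_record: "subspace U \<Longrightarrow> U \<subseteq> A \<Longrightarrow> vsubspace (subspace_record scale A) U"
  by (auto simp: vsubspace_def subspace_0 subspace_add subspace_scale)

text \<open>Extend a basis of \<open>U\<close> to the whole space and kill the basis vectors in \<open>U\<close>.  The image of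
  \<open>\<pi>\<close> is a model of the quotient by \<open>U\<close> inside the original type.\<close>
lemma exists_linear_with_kernel:
  assumes "subspace U"
  obtains \<pi> where "Vector_Spaces.linear scale scale \<pi>" "\<And>x. \<pi> x = 0 \<longleftrightarrow> x \<in> U"
proof -
  interpret p: vector_space_pair scale scale by unfold_locales
  obtain B0 where B0: "B0 \<subseteq> U" "independent B0" "U \<subseteq> span B0"
    using maximal_independent_subset by metis
  have sB0: "span B0 = U" using B0 assms by (simp add: span_subspace)
  obtain B1 where B1: "B0 \<subseteq> B1" "independent B1" "UNIV \<subseteq> span B1"
    using maximal_independent_subset_extend[OF subset_UNIV B0(2)] by metis
  define \<pi> where "\<pi> = p.construct B1 (\<lambda>b. if b \<in> B0 then 0 else b)"
  have lin: "Vector_Spaces.linear scale scale \<pi>"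
    unfolding \<pi>_def by (rule p.linear_construct[OF B1(2)])
  interpret l: Vector_Spaces.linear scale scale \<pi> by fact
  have b: "b \<in> B1 \<Longrightarrow> \<pi> b = (if b \<in> B0 then 0 else b)" for b
    unfolding \<pi>_def by (rule p.construct_basis[OF B1(2)])
  have 1: "\<pi> x = 0" if "x \<in> U" for x
  proof (rule l.eq_0_on_span)
    show "x \<in> span B0" using that sB0 by simp
    show "\<pi> y = 0" if "y \<in> B0" for y using b B1(1) that by auto
  qed
  have 2: "\<pi> x = x" if "x \<in> span (B1 - B0)" for x
  proof -
    have "Vector_Spaces.linear scale scale (\<lambda>x. x)" by unfold_locales auto
    from p.linear_eq_on[OF lin this that] b show ?thesis by auto
  qed
  have "x \<in> U" if "\<pi> x = 0" for x
  proof -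
    have "x \<in> span (B0 \<union> (B1 - B0))" using B1 by (auto simp: Un_absorb1)
    then obtain y z where "x = y + z" "y \<in> span B0" "z \<in> span (B1 - B0)"
      unfolding span_Un by auto
    then show ?thesis using that 1[of y] 2[of z] sB0 by (simp add: l.add)
  qed
  with 1 lin that show ?thesis by blast
qed

lemma vector_space_prod: "vector_space (prod_scale scale)"
  by unfold_locales
    (auto simp: prod_scale_def scale_right_distrib scale_left_distrib prod_eq_iff)

lemma prod_basis:
  assumes "independent S" "independent T"
  shows "\<not> module.dependent (prod_scale scale) ((\<lambda>x. (x, 0)) ` S \<union> (\<lambda>y. (0, y)) ` T)"
    and "module.span (prod_scale scale) ((\<lambda>x. (x, 0)) ` S \<union> (\<lambda>y. (0, y)) ` T) = span S \<times> span T"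
    and "|(\<lambda>x. (x, 0 :: 'b)) ` S \<union> (\<lambda>y. (0 :: 'b, y)) ` T| =o |S| +c |T|"
proof -
  interpret P: vector_space "prod_scale scale" by (rule vector_space_prod)
  let ?l = "\<lambda>x. (x, 0 :: 'b)" and ?r = "\<lambda>y. (0 :: 'b, y)"
  have l: "Vector_Spaces.linear scale (prod_scale scale) ?l"
    and r: "Vector_Spaces.linear scale (prod_scale scale) ?r"
    by unfold_locales (auto simp: prod_scale_def)
  have sp: "P.span (?l ` S \<union> ?r ` T) = span S \<times> span T" for S T
    unfolding P.span_Un module_hom.span_image[OF l[THEN linear_iff_module_hom[THEN iffD1]]]
      module_hom.span_image[OF r[THEN linear_iff_module_hom[THEN iffD1]]]
    by force
  then show "P.span (?l ` S \<union> ?r ` T) = span S \<times> span T" .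
  have S0: "0 \<notin> S" and T0: "0 \<notin> T"
    using assms dependent_zero by blast+
  show "P.independent (?l ` S \<union> ?r ` T)"
  proof
    assume "P.dependent (?l ` S \<union> ?r ` T)"
    then obtain z where z: "z \<in> ?l ` S \<union> ?r ` T" "z \<in> P.span ((?l ` S \<union> ?r ` T) - {z})"
      unfolding P.dependent_def by blast
    from z(1) show False
    proof
      assume "z \<in> ?l ` S"
      then obtain x where x: "x \<in> S" "z = (x, 0)" by auto
      then have "(?l ` S \<union> ?r ` T) - {z} = ?l ` (S - {x}) \<union> ?r ` T" using S0 by auto
      then show False using z(2) x assms(1) by (auto simp: sp dependent_def)
    next
      assume "z \<in> ?r ` T"
      then obtain y where y: "y \<in> T" "z = (0, y)" by auto
      then have "(?l ` S \<union> ?r ` T) - {z} = ?l ` S \<union> ?r ` (T - {y})" using T0 by auto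
      then show False using z(2) y assms(2) by (auto simp: sp dependent_def)
    qed
  qed
  have "bij_betw (case_sum ?l ?r) (S <+> T) (?l ` S \<union> ?r ` T)"
    using S0 T0 by (auto simp: bij_betw_def inj_on_def image_Un Plus_def image_image)
  then have "|S <+> T| =o |?l ` S \<union> ?r ` T|" by (rule card_of_ordIsoI)
  from ordIso_transitive[OF ordIso_symmetric[OF this] Plus_csum]
  show "|?l ` S \<union> ?r ` T| =o |S| +c |T|" .
qed

end


section \<open>Complexes with a null-homotopic injective endomorphism\<close>

text \<open>A cochain complex \<open>(C, d)\<close> with an injective endomorphism \<open>e\<close> that is null-homotopic in
  positive degrees, by the homotopy \<open>h\<close>.  In the application \<open>e\<close> is the action of \<open>\<partial>\<close> and \<open>h\<close> is
  the contraction with \<open>L\<close> at \<open>\<lambda> = 0\<close>.\<close>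
locale null_homotopic_complex = vector_space scale
  for scale :: "'f::field \<Rightarrow> 'e::ab_group_add \<Rightarrow> 'e" (infixr "*s" 75) +
  fixes C :: "nat \<Rightarrow> 'e set" and d e h :: "nat \<Rightarrow> 'e \<Rightarrow> 'e"
  assumes subspace_C: "subspace (C q)"
    and d_closed: "x \<in> C q \<Longrightarrow> d q x \<in> C (Suc q)"
    and d_add: "x \<in> C q \<Longrightarrow> y \<in> C q \<Longrightarrow> d q (x + y) = d q x + d q y"
    and d_scale: "x \<in> C q \<Longrightarrow> d q (c *s x) = c *s d q x"
    and d_d: "x \<in> C q \<Longrightarrow> d (Suc q) (d q x) = 0"
    and e_closed: "x \<in> C q \<Longrightarrow> e q x \<in> C q"
    and e_add: "x \<in> C q \<Longrightarrow> y \<in> C q \<Longrightarrow> e q (x + y) = e q x + e q y"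
    and e_scale: "x \<in> C q \<Longrightarrow> e q (c *s x) = c *s e q x"
    and e_inj: "x \<in> C q \<Longrightarrow> e q x = 0 \<Longrightarrow> x = 0"
    and d_e: "x \<in> C q \<Longrightarrow> d q (e q x) = e (Suc q) (d q x)"
    and h_closed: "x \<in> C (Suc q) \<Longrightarrow> h q x \<in> C q"
    and h_add: "x \<in> C (Suc q) \<Longrightarrow> y \<in> C (Suc q) \<Longrightarrow> h q (x + y) = h q x + h q y"
    and h_scale: "x \<in> C (Suc q) \<Longrightarrow> h q (c *s x) = c *s h q x"
    and homotopy: "x \<in> C (Suc q) \<Longrightarrow> d q (h q x) + h (Suc q) (d (Suc q) x) = e (Suc q) x"
begin

abbreviation V :: "nat \<Rightarrow> ('f, 'e) vspace"
  where "V q \<equiv> subspace_record scale (C q)"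

abbreviation R :: "nat \<Rightarrow> ('f, 'e set) vspace"
  where "R q \<equiv> quot (V q) (e q ` C q)"

abbreviation dR :: "nat \<Rightarrow> 'e set \<Rightarrow> 'e set"
  where "dR q \<equiv> quot_map (V (Suc q)) (e (Suc q) ` C (Suc q)) (d q)"

definition Z :: "nat \<Rightarrow> 'e set"
  where "Z q = {x \<in> C q. d q x = 0}"

lemma C_0: "0 \<in> C q" and C_add: "x \<in> C q \<Longrightarrow> y \<in> C q \<Longrightarrow> x + y \<in> C q"
  and C_diff: "x \<in> C q \<Longrightarrow> y \<in> C q \<Longrightarrow> x - y \<in> C q"
  and C_scale: "x \<in> C q \<Longrightarrow> c *s x \<in> C q"
  using subspace_C[of q] by (auto simp: subspace_0 subspace_add subspace_diff subspace_scale)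

lemma d_0: "d q 0 = 0" and e_0: "e q 0 = 0" and h_0: "h q 0 = 0"
  using d_add[OF C_0 C_0] e_add[OF C_0 C_0] h_add[OF C_0 C_0] by simp_all

lemma d_diff: "x \<in> C q \<Longrightarrow> y \<in> C q \<Longrightarrow> d q (x - y) = d q x - d q y"
  and e_diff: "x \<in> C q \<Longrightarrow> y \<in> C q \<Longrightarrow> e q (x - y) = e q x - e q y"
  using d_add[of "x - y" q y] e_add[of "x - y" q y] C_diff by auto

lemma e_eq_iff: "x \<in> C q \<Longrightarrow> y \<in> C q \<Longrightarrow> e q x = e q y \<longleftrightarrow> x = y"
  using e_inj[of "x - y" q] by (auto simp: e_diff C_diff)

lemma subspace_Z: "subspace (Z q)"
  by (rule subspaceI) (auto simp: Z_def C_0 C_add C_scale d_0 d_add d_scale)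

lemma subspace_d: "subspace (d q ` C q)"
  by (rule subspaceI)
    (auto simp: d_add[symmetric] d_scale[symmetric] C_add C_scale intro: image_eqI[of _ _ 0] C_0 simp: d_0)

lemma subspace_e: "subspace (e q ` C q)"
  by (rule subspaceI)
    (auto simp: e_add[symmetric] e_scale[symmetric] C_add C_scale intro: image_eqI[of _ _ 0] C_0 simp: e_0)

lemma vdim_cohomology:
  assumes g: "Vector_Spaces.linear scale scale g" and ker: "\<And>x. g x = 0 \<longleftrightarrow> x \<in> d p ` C p"
    and T: "independent T" "span T = g ` Z (Suc p)"
  shows "vdim (cohomology V d (Suc p)) =o |T|"
proof -
  interpret g: Vector_Spaces.linear scale scale g by fact
  interpret Z: vec "subspace_record scale (Z (Suc p))" by (rule vec_subspace_record[OF subspace_Z])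
  have BZ: "d p ` C p \<subseteq> Z (Suc p)" by (auto simp: Z_def d_closed d_d)
  have B: "vsubspace (subspace_record scale (Z (Suc p))) (d p ` C p)"
    by (rule vsubspace_subspace_record[OF subspace_d BZ])
  interpret Q: vec "quot (subspace_record scale (Z (Suc p))) (d p ` C p)" by (rule Z.vec_quot[OF B])
  have gl: "vlin scale (subspace_record scale (Z (Suc p))) g" by (simp add: vlin_def g.add g.scale)
  have g0: "u \<in> d p ` C p \<Longrightarrow> g u = 0" for u using ker by simp
  note lift = Z.quot_lift[OF B gl g0]
  have "vdim (quot (subspace_record scale (Z (Suc p))) (d p ` C p)) =o |T|"
  proof (rule Q.vdim_eq)
    show "vector_space scale" by (rule vector_space_axioms)
    show "vlin scale (quot (subspace_record scale (Z (Suc p))) (d p ` C p)) (\<lambda>X. g (SOME y. y \<in> X))"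
      by (rule Z.vlin_quot_lift[OF B gl g0])
    show "span T = (\<lambda>X. g (SOME y. y \<in> X)) ` carr (quot (subspace_record scale (Z (Suc p))) (d p ` C p))"
      unfolding T(2) Z.carr_quot[OF B] image_image by (rule image_cong) (simp_all add: lift)
    fix X assume "X \<in> carr (quot (subspace_record scale (Z (Suc p))) (d p ` C p))"
      and 0: "g (SOME y. y \<in> X) = 0"
    then obtain x where x: "x \<in> Z (Suc p)" "X = coset (subspace_record scale (Z (Suc p))) (d p ` C p) x"
      by (auto simp: Z.carr_quot[OF B])
    then have "x \<in> d p ` C p" using 0 ker by (simp add: lift)
    then show "X = vzero (quot (subspace_record scale (Z (Suc p))) (d p ` C p))"
      using x(2) Z.coset_zero[OF B] by (simp add: quot_def)
  qed (rule T(1))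
  then show ?thesis by (simp add: cohomology_def Z_def)
qed

text \<open>The connecting map of \<open>0 \<rightarrow> e C \<rightarrow> C \<rightarrow> C / e C \<rightarrow> 0\<close>, followed by the isomorphism \<open>e C \<cong> C\<close>.\<close>
definition \<delta> :: "nat \<Rightarrow> 'e \<Rightarrow> 'e"
  where "\<delta> q x = inv_into (C (Suc q)) (e (Suc q)) (d q x)"

text \<open>Representatives of the cocycles of \<open>C / e C\<close>.\<close>
definition Z' :: "nat \<Rightarrow> 'e set"
  where "Z' q = {x \<in> C q. d q x \<in> e (Suc q) ` C (Suc q)}"

lemma Z'_C: "x \<in> Z' q \<Longrightarrow> x \<in> C q"
  by (simp add: Z'_def)

lemma \<delta>_C: "x \<in> Z' q \<Longrightarrow> \<delta> q x \<in> C (Suc q)"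
  and e_\<delta>: "x \<in> Z' q \<Longrightarrow> e (Suc q) (\<delta> q x) = d q x"
  by (simp_all add: \<delta>_def Z'_def inv_into_into f_inv_into_f)

lemma Z'I: "x \<in> C q \<Longrightarrow> y \<in> C (Suc q) \<Longrightarrow> d q x = e (Suc q) y \<Longrightarrow> x \<in> Z' q"
  by (simp add: Z'_def)

lemma \<delta>_eqI: "x \<in> C q \<Longrightarrow> y \<in> C (Suc q) \<Longrightarrow> d q x = e (Suc q) y \<Longrightarrow> \<delta> q x = y"
  using e_eq_iff[of "\<delta> q x" "Suc q" y] Z'I[of x q y] \<delta>_C[of x q] e_\<delta>[of x q] by auto

lemma \<delta>_add: "x \<in> Z' q \<Longrightarrow> y \<in> Z' q \<Longrightarrow> \<delta> q (x + y) = \<delta> q x + \<delta> q y"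
  by (rule \<delta>_eqI) (simp_all add: Z'_C C_add \<delta>_C d_add e_add e_\<delta>)

lemma \<delta>_scale: "x \<in> Z' q \<Longrightarrow> \<delta> q (c *s x) = c *s \<delta> q x"
  by (rule \<delta>_eqI) (simp_all add: Z'_C C_scale \<delta>_C d_scale e_scale e_\<delta>)

lemma subspace_Z': "subspace (Z' q)"
proof (rule subspaceI)
  show "0 \<in> Z' q" using Z'I[OF C_0 C_0] by (simp add: d_0 e_0)
  show "x + y \<in> Z' q" if "x \<in> Z' q" "y \<in> Z' q" for x y
    using that Z'I[of "x + y" q "\<delta> q x + \<delta> q y"]
    by (simp add: Z'_C C_add \<delta>_C d_add e_add e_\<delta>)
  show "c *s x \<in> Z' q" if "x \<in> Z' q" for c x
    using that Z'I[of "c *s x" q "c *s \<delta> q x"]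
    by (simp add: Z'_C C_scale \<delta>_C d_scale e_scale e_\<delta>)
qed

lemma \<delta>_Z:
  assumes "x \<in> Z' q" shows "\<delta> q x \<in> Z (Suc q)"
proof -
  have "e (Suc (Suc q)) (d (Suc q) (\<delta> q x)) = d (Suc q) (d q x)"
    using assms by (simp add: d_e[symmetric] \<delta>_C e_\<delta>)
  then have "d (Suc q) (\<delta> q x) = 0"
    using assms e_inj[of "d (Suc q) (\<delta> q x)" "Suc (Suc q)"]
    by (simp add: d_d Z'_C d_closed \<delta>_C)
  then show ?thesis using assms by (simp add: Z_def \<delta>_C)
qed

text \<open>On cocycles the homotopy is a right inverse of the connecting map, so \<open>\<delta>\<close> is onto; this is
  where the long exact sequence breaks up into short ones.\<close>
lemma h_Z: "y \<in> Z (Suc q) \<Longrightarrow> h q y \<in> Z' q" and \<delta>_h: "y \<in> Z (Suc q) \<Longrightarrow> \<delta> q (h q y) = y"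
  and d_h: "y \<in> Z (Suc q) \<Longrightarrow> d q (h q y) = e (Suc q) y"
proof -
  assume y: "y \<in> Z (Suc q)"
  then show "d q (h q y) = e (Suc q) y"
    using homotopy[of y q] by (simp add: Z_def h_0)
  then show "h q y \<in> Z' q" "\<delta> q (h q y) = y"
    using y by (auto simp: Z_def h_closed intro: Z'I \<delta>_eqI)
qed

lemma Z_Z': "x \<in> Z q \<Longrightarrow> x \<in> Z' q" and \<delta>_0: "x \<in> Z q \<Longrightarrow> \<delta> q x = 0"
  by (auto simp: Z_def e_0 C_0 intro: Z'I[OF _ C_0] \<delta>_eqI[OF _ C_0])

lemma decompose_Z:
  assumes "x \<in> Z' q" shows "x - h q (\<delta> q x) \<in> Z q"
  using assms d_h[OF \<delta>_Z[OF assms]] by (simp add: Z_def C_diff d_diff Z'_C h_closed \<delta>_C e_\<delta>)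

text \<open>The map \<open>x \<mapsto> (x - h (\<delta> x), \<delta> x)\<close> identifies a cocycle of the quotient complex with a pair of
  cocycles of \<open>C\<close> in degrees \<open>q\<close> and \<open>q + 1\<close>; its inverse is \<open>(z, y) \<mapsto> z + h y\<close>.  The coboundaries
  \<open>d w + e u\<close> correspond to pairs of coboundaries, because \<open>\<delta> (e u) = d u\<close> and
  \<open>e u - h (d u) = d (h u)\<close>.  Composed with the models of the two cohomology spaces this embeds the
  cohomology of \<open>C / e C\<close> into a product.\<close>
theorem vdim_reduced:
  "vdim (cohomology R dR (Suc p)) =o vdim (cohomology V d (Suc p)) +c vdim (cohomology V d (Suc (Suc p)))"
proof -
  let ?q = "Suc p"
  obtain g1 where g1: "Vector_Spaces.linear scale scale g1" "\<And>x. g1 x = 0 \<longleftrightarrow> x \<in> d p ` C p"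
    using exists_linear_with_kernel[OF subspace_d] by blast
  obtain g2 where g2: "Vector_Spaces.linear scale scale g2" "\<And>x. g2 x = 0 \<longleftrightarrow> x \<in> d ?q ` C ?q"
    using exists_linear_with_kernel[OF subspace_d] by blast
  interpret g1: Vector_Spaces.linear scale scale g1 by fact
  interpret g2: Vector_Spaces.linear scale scale g2 by fact
  have sub1: "subspace (g1 ` Z ?q)" by (rule g1.subspace_image[OF subspace_Z])
  have sub2: "subspace (g2 ` Z (Suc ?q))" by (rule g2.subspace_image[OF subspace_Z])
  obtain S where S: "independent S" "span S = g1 ` Z ?q"
    using maximal_independent_subset[of "g1 ` Z ?q"] span_subspace[OF _ _ sub1] by metis
  obtain T where T: "independent T" "span T = g2 ` Z (Suc ?q)"
    using maximal_independent_subset[of "g2 ` Z (Suc ?q)"] span_subspace[OF _ _ sub2] by metis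
  define g where "g x = (g1 (x - h ?q (\<delta> ?q x)), g2 (\<delta> ?q x))" for x
  let ?s = "prod_scale scale"
  let ?V = "subspace_record scale (Z' ?q)" and ?I = "e ?q ` C ?q"
  interpret V: vec ?V by (rule vec_subspace_record[OF subspace_Z'])
  have IZ: "?I \<subseteq> Z' ?q"
    using Z'I[OF e_closed d_closed d_e] by auto
  have I: "vsubspace ?V ?I" by (rule vsubspace_subspace_record[OF subspace_e IZ])
  have gl: "vlin ?s ?V g"
    by (simp add: vlin_def g_def prod_scale_def \<delta>_add \<delta>_scale h_add h_scale \<delta>_C
        g1.add[symmetric] g1.scale[symmetric] g2.add g2.scale scale_right_diff_distrib)
       (simp add: algebra_simps)
  have g_e: "g (e ?q u) = 0" if u: "u \<in> C ?q" for u
  proof -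
    have "\<delta> ?q (e ?q u) = d ?q u"
      using u by (intro \<delta>_eqI) (simp_all add: e_closed d_closed d_e)
    moreover have "e ?q u - h ?q (d ?q u) = d p (h p u)"
      using homotopy[OF u] by (simp add: algebra_simps)
    ultimately show ?thesis
      using u g1(2) g2(2) h_closed by (auto simp: g_def zero_prod_def)
  qed
  have g_d: "g (d p w) = 0" if "w \<in> C p" for w
    using that g1(2) \<delta>_0[of "d p w" ?q] by (auto simp: g_def zero_prod_def Z_def d_closed d_d h_0)
  \<comment> \<open>The kernel consists of the representatives of coboundaries.\<close>
  have g_0: "x \<in> (\<lambda>(w, u). d p w + e ?q u) ` (C p \<times> C ?q)" if x: "x \<in> Z' ?q" and "g x = 0" for x
  proof -
    have "g1 (x - h ?q (\<delta> ?q x)) = 0" "g2 (\<delta> ?q x) = 0"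
      using \<open>g x = 0\<close> by (simp_all add: g_def zero_prod_def)
    then obtain w u where w: "w \<in> C p" "x - h ?q (\<delta> ?q x) = d p w"
      and u: "u \<in> C ?q" "\<delta> ?q x = d ?q u"
      using g1(2) g2(2) by auto
    \<comment> \<open>\<open>h (d u)\<close> is rewritten by the homotopy formula, which leaves only \<open>d\<close>- and \<open>e\<close>-images.\<close>
    have "x = d p w + (e ?q u - d p (h p u))"
      using w(2) homotopy[OF u(1)] unfolding u(2) by (simp add: algebra_simps)
    also have "\<dots> = d p (w - h p u) + e ?q u"
      using w(1) u(1) by (simp add: d_diff h_closed)
    finally show ?thesis using w(1) u(1) by (force simp: C_diff h_closed)
  qed
  have img: "g ` Z' ?q = g1 ` Z ?q \<times> g2 ` Z (Suc ?q)"
  proof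
    show "g ` Z' ?q \<subseteq> g1 ` Z ?q \<times> g2 ` Z (Suc ?q)"
      by (auto simp: g_def decompose_Z \<delta>_Z)
    show "g1 ` Z ?q \<times> g2 ` Z (Suc ?q) \<subseteq> g ` Z' ?q"
    proof clarify
      fix z y assume zy: "z \<in> Z ?q" "y \<in> Z (Suc ?q)"
      have "\<delta> ?q (z + h ?q y) = y"
        using zy by (simp add: \<delta>_add Z_Z' h_Z \<delta>_0 \<delta>_h)
      then have "g (z + h ?q y) = (g1 z, g2 y)" by (simp add: g_def)
      moreover have "z + h ?q y \<in> Z' ?q"
        using zy by (simp add: Z_Z' h_Z subspace_add[OF subspace_Z'])
      ultimately show "(g1 z, g2 y) \<in> g ` Z' ?q" by (metis image_eqI)
    qed
  qed

  let ?W = "quot ?V ?I"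
  define U where "U = coset ?V ?I ` d p ` C p"
  interpret W: vec ?W by (rule V.vec_quot[OF I])
  have g_I: "u \<in> ?I \<Longrightarrow> g u = 0" for u using g_e by auto
  let ?g = "\<lambda>X. g (SOME y. y \<in> X)"
  have lift: "?g (coset ?V ?I x) = g x" if "x \<in> Z' ?q" for x
    using V.quot_lift[OF I gl g_I] that by simp
  have dZ': "d p ` C p \<subseteq> Z' ?q"
    by (auto simp: Z_def d_closed d_d intro: Z_Z')
  have gW: "vlin ?s ?W ?g" by (rule V.vlin_quot_lift[OF I gl g_I])
  have U: "vsubspace ?W U"
    unfolding vsubspace_def U_def
  proof (intro conjI ballI allI)
    show "coset ?V ?I ` d p ` C p \<subseteq> carr ?W" using dZ' by (auto simp: V.carr_quot[OF I])
    show "vzero ?W \<in> coset ?V ?I ` d p ` C p"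
      using subspace_0[OF subspace_d] by (auto simp: V.quot_zero[OF I])
    fix X Y c assume X: "X \<in> coset ?V ?I ` d p ` C p" and Y: "Y \<in> coset ?V ?I ` d p ` C p"
    obtain x y where xy: "x \<in> d p ` C p" "X = coset ?V ?I x" "y \<in> d p ` C p" "Y = coset ?V ?I y"
      using X Y by blast
    have xyZ: "x \<in> Z' ?q" "y \<in> Z' ?q" using xy dZ' by auto
    show "vadd ?W X Y \<in> coset ?V ?I ` d p ` C p"
      unfolding xy(2,4) using V.quot_add[OF I, of x y] xyZ subspace_add[OF subspace_d xy(1,3)]
      by simp
    show "vscale ?W c X \<in> coset ?V ?I ` d p ` C p"
      unfolding xy(2) using V.quot_scale[OF I, of x c] xyZ subspace_scale[OF subspace_d xy(1)]
      by simp
  qed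
  have gU: "?g X = 0" if "X \<in> U" for X
    using that g_d dZ' lift by (auto simp: U_def)
  interpret H: vec "quot ?W U" by (rule W.vec_quot[OF U])
  note ST = prod_basis[OF S(1) T(1)]
  have carrW: "carr ?W = coset ?V ?I ` Z' ?q" by (simp add: V.carr_quot[OF I])
  have lift2: "?g (SOME Y. Y \<in> coset ?W U (coset ?V ?I x)) = g x" if "x \<in> Z' ?q" for x
    using W.quot_lift[OF U gW gU, of "coset ?V ?I x"] lift[OF that] carrW that by simp
  have "vdim (quot ?W U) =o |(\<lambda>x. (x, 0)) ` S \<union> (\<lambda>y. (0, y)) ` T|"
  proof (rule H.vdim_eq[OF vector_space_prod W.vlin_quot_lift[OF U gW gU] _ ST(1)])
    have "(\<lambda>X. ?g (SOME Y. Y \<in> X)) ` carr (quot ?W U) = g ` Z' ?q"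
      unfolding W.carr_quot[OF U] carrW image_image
      by (rule image_cong) (simp_all add: lift2)
    then show "module.span ?s ((\<lambda>x. (x, 0)) ` S \<union> (\<lambda>y. (0, y)) ` T)
      = (\<lambda>X. ?g (SOME Y. Y \<in> X)) ` carr (quot ?W U)"
      using ST(2) S(2) T(2) img by simp
    fix X assume "X \<in> carr (quot ?W U)" and 0: "?g (SOME Y. Y \<in> X) = 0"
    then obtain x where x: "x \<in> Z' ?q" "X = coset ?W U (coset ?V ?I x)"
      by (auto simp: W.carr_quot[OF U] carrW)
    have "g x = 0"
      using 0 x by (simp add: lift2)
    from g_0[OF x(1) this] obtain w u where wu: "w \<in> C p" "u \<in> C ?q" "x = d p w + e ?q u"
      by auto
    have "coset ?V ?I x = coset ?V ?I (d p w)"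
      using V.coset_add_U[OF I, of "d p w" "e ?q u"] wu dZ' by auto
    then show "X = vzero (quot ?W U)"
      using x(2) wu(1) W.coset_zero[OF U, of "coset ?V ?I x"] by (simp add: quot_def U_def)
  qed
  then have "vdim (quot ?W U) =o |S| +c |T|"
    using ST(3) by (rule ordIso_transitive)
  moreover have "cohomology R dR ?q = quot ?W U"
  proof -
    have dR: "dR r (coset (V r) (e r ` C r) x)
      = coset (V (Suc r)) (e (Suc r) ` C (Suc r)) (d r x)" if x: "x \<in> C r" for r x
    proof -
      interpret C: vec "V (Suc r)" by (rule vec_subspace_record[OF subspace_C])
      have E: "vsubspace (V (Suc r)) (e (Suc r) ` C (Suc r))"
        by (rule vsubspace_subspace_record[OF subspace_e]) (auto simp: e_closed)
      have "coset (V (Suc r)) (e (Suc r) ` C (Suc r)) (d r (x + e r u))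
        = coset (V (Suc r)) (e (Suc r) ` C (Suc r)) (d r x)" if u: "u \<in> C r" for u
        using C.coset_add_U[OF E, of "d r x" "e (Suc r) (d r u)"] x u
        by (simp add: d_add e_closed d_e d_closed)
      then show ?thesis
        using C_0[of r] by (auto simp: quot_map_def coset_subspace_record[of _ "C r"])
    qed
    have zero: "coset (V r) (e r ` C r) y = vzero (R r) \<longleftrightarrow> y \<in> e r ` C r" if y: "y \<in> C r" for r y
    proof -
      interpret C: vec "V r" by (rule vec_subspace_record[OF subspace_C])
      have E: "vsubspace (V r) (e r ` C r)"
        by (rule vsubspace_subspace_record[OF subspace_e]) (auto simp: e_closed)
      show ?thesis
        using C.coset_zero[OF E] C.self_in_coset[OF E, of y] y by (auto simp: quot_def)
    qed
    have zero_e: "coset (V r) (e r ` C r) (e r u) = vzero (R r)" if "u \<in> C r" for r u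
      using zero[OF e_closed[OF that]] that by blast
    have "{X \<in> carr (R ?q). dR ?q X = vzero (R (Suc ?q))} = coset (V ?q) ?I ` Z' ?q"
      by (auto simp: quot_def[of "V ?q"] dR zero zero_e d_closed Z'_def)
    moreover have "dR p ` carr (R p) = coset (V ?q) ?I ` d p ` C p"
      by (auto simp: quot_def[of "V p"] image_image dR)
    moreover have "coset (V ?q) ?I = coset ?V ?I"
      by (simp add: fun_eq_iff coset_subspace_record)
    ultimately show ?thesis
      by (simp add: cohomology_def quot_def subspace_record_def coset_def U_def)
  qed
  ultimately have 1: "vdim (cohomology R dR ?q) =o |S| +c |T|" by simp
  have 2: "|S| +c |T| =o vdim (cohomology V d ?q) +c vdim (cohomology V d (Suc ?q))"
    by (intro csum_cong ordIso_symmetric[OF vdim_cohomology[OF g1 S]]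
        ordIso_symmetric[OF vdim_cohomology[OF g2 T]])
  from ordIso_transitive[OF 1 2] show ?thesis .
qed

end

section \<open>Values of polynomials in the variables \<open>\<lambda>\<^sub>i\<close>\<close>

definition mon :: "(nat \<Rightarrow> 'f::comm_ring_1) \<Rightarrow> (nat \<Rightarrow>\<^sub>0 nat) \<Rightarrow> 'f"
  where "mon c t = (\<Prod>i\<in>Poly_Mapping.keys t. c i ^ Poly_Mapping.lookup t i)"

definition ev :: "('f::comm_ring_1 poly \<Rightarrow> 'm::ab_group_add \<Rightarrow> 'm) \<Rightarrow> (nat \<Rightarrow> 'f) \<Rightarrow> 'm lpoly \<Rightarrow> 'm"
  where "ev s c p = (\<Sum>t\<in>Poly_Mapping.keys p. s [:mon c t:] (Poly_Mapping.lookup p t))"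

definition pev :: "('f::comm_ring_1 poly \<Rightarrow> 'm::ab_group_add \<Rightarrow> 'm) \<Rightarrow> 'f \<Rightarrow> 'm poly \<Rightarrow> 'm"
  where "pev s c p = (\<Sum>n\<le>degree p. s [:c ^ n:] (coeff p n))"

lemma mon_superset:
  assumes "finite S" "Poly_Mapping.keys t \<subseteq> S"
  shows "mon c t = (\<Prod>i\<in>S. c i ^ Poly_Mapping.lookup t i)"
  unfolding mon_def using assms
  by (intro prod.mono_neutral_left) (auto simp: in_keys_iff)

lemma mon_add: "mon c (t + u) = mon c t * mon c u"
proof -
  let ?S = "Poly_Mapping.keys t \<union> Poly_Mapping.keys u"
  have "Poly_Mapping.keys (t + u) \<subseteq> ?S" by (rule Poly_Mapping.keys_add)
  then show ?thesis
    by (simp add: mon_superset[of ?S] lookup_add power_add prod.distrib)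
qed

lemma mon_0 [simp]: "mon c 0 = 1"
  by (simp add: mon_def)

lemma mon_single [simp]: "mon c (Poly_Mapping.single i n) = c i ^ n"
  by (simp add: mon_superset[of "{i}"])

lemma mon_cong: "(\<And>i. i \<in> Poly_Mapping.keys t \<Longrightarrow> c i = c' i) \<Longrightarrow> mon c t = mon c' t"
  by (simp add: mon_def)

text \<open>Rescaling one variable multiplies each monomial by a power that records one exponent; this is
  what separates monomials below.\<close>
lemma mon_upd: "mon (c(i := x * c i)) t = x ^ Poly_Mapping.lookup t i * mon c t"
proof -
  let ?S = "insert i (Poly_Mapping.keys t)"
  have e: "(\<Prod>j\<in>?S - {i}. (c(i := x * c i)) j ^ Poly_Mapping.lookup t j)
    = (\<Prod>j\<in>?S - {i}. c j ^ Poly_Mapping.lookup t j)"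
    by (rule prod.cong) auto
  show ?thesis
    unfolding mon_superset[of ?S t _, OF finite.insertI[OF finite_keys] subset_insertI]
    by (subst (1 2) prod.remove[of ?S i])
       (simp_all add: e power_mult_distrib mult.assoc del: fun_upd_apply,
        simp add: power_mult_distrib mult.assoc)
qed

locale poly_module = module s
  for s :: "'f::field_char_0 poly \<Rightarrow> 'm::ab_group_add \<Rightarrow> 'm"
begin

lemma ev_superset:
  assumes "finite S" "Poly_Mapping.keys p \<subseteq> S"
  shows "ev s c p = (\<Sum>t\<in>S. s [:mon c t:] (Poly_Mapping.lookup p t))"
  unfolding ev_def using assms
  by (intro sum.mono_neutral_left) (auto simp: in_keys_iff)

lemma ev_0 [simp]: "ev s c 0 = 0"
  by (simp add: ev_def)

lemma ev_add: "ev s c (p + q) = ev s c p + ev s c q"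
proof -
  let ?S = "Poly_Mapping.keys p \<union> Poly_Mapping.keys q"
  have "Poly_Mapping.keys (p + q) \<subseteq> ?S" by (rule Poly_Mapping.keys_add)
  then show ?thesis
    by (simp add: ev_superset[of ?S] lookup_add scale_right_distrib sum.distrib)
qed

lemma ev_uminus: "ev s c (- p) = - ev s c p"
  using ev_add[of c p "- p"] by (simp add: add_eq_0_iff)

lemma ev_diff: "ev s c (p - q) = ev s c p - ev s c q"
  using ev_add[of c p "- q"] by (simp add: ev_uminus)

lemma ev_sum: "ev s c (sum f I) = (\<Sum>i\<in>I. ev s c (f i))"
  by (induction I rule: infinite_finite_induct) (simp_all add: ev_add)

lemma ev_single [simp]: "ev s c (Poly_Mapping.single t m) = s [:mon c t:] m"
  by (simp add: ev_superset[of "{t}"])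

lemma ev_const [simp]: "ev s c (const m) = m"
  by (simp add: const_def one_pCons[symmetric])

lemma ev_cong:
  assumes "\<And>t. t \<in> Poly_Mapping.keys p \<Longrightarrow> Poly_Mapping.keys t \<subseteq> {..<q}"
    and "\<And>i. i < q \<Longrightarrow> c i = c' i"
  shows "ev s c p = ev s c' p"
  unfolding ev_def
  by (intro sum.cong refl arg_cong[where f = "\<lambda>x. s [:x:] _"] mon_cong) (use assms in blast)

text \<open>The polynomial \<open>r\<close> may involve \<open>\<partial>\<close>, so its value is an element of the polynomial ring that acts
  on \<open>M\<close>.\<close>
lemma ev_lscale: "ev s c (lscale s r p) = s (ev (*) c r) (ev s c p)"
proof -
  have "ev s c (lscale s r p) = (\<Sum>u\<in>Poly_Mapping.keys r. \<Sum>t\<in>Poly_Mapping.keys p.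
      s ([:mon c u:] * Poly_Mapping.lookup r u) (s [:mon c t:] (Poly_Mapping.lookup p t)))"
    unfolding lscale_def ev_sum ev_single
    by (intro sum.cong refl) (simp add: mon_add mult.commute)
  also have "\<dots> = s (ev (*) c r) (ev s c p)"
    unfolding ev_def scale_sum_left scale_sum_right by (rule sum.swap)
  finally show ?thesis .
qed

lemma pev_bound: "degree p \<le> N \<Longrightarrow> pev s c p = (\<Sum>n\<le>N. s [:c ^ n:] (coeff p n))"
  unfolding pev_def
  by (intro sum.mono_neutral_left) (auto simp: coeff_eq_0)

lemma pev_add: "pev s c (p + q) = pev s c p + pev s c q"
proof -
  let ?N = "max (degree p) (degree q)"
  show ?thesis
    by (simp add: pev_bound[of _ ?N] degree_add_le scale_right_distrib sum.distrib)
qed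

lemma pev_0: "pev s 0 p = coeff p 0"
proof -
  have "pev s 0 p = (\<Sum>n\<in>{0}. s [:0 ^ n:] (coeff p n))"
    unfolding pev_def by (rule sum.mono_neutral_right) (auto simp: zero_power)
  then show ?thesis by (simp add: one_pCons[symmetric])
qed

lemma pev_map_poly: "pev s c (map_poly (s [:k:]) p) = s [:k:] (pev s c p)"
  by (simp add: pev_bound[of _ "degree p"] map_poly_degree_leq coeff_map_poly scale_sum_right
      mult.commute)

text \<open>Given \<open>u\<close> and another monomial \<open>t\<close>, choose a variable with different exponents in the two.  The
  difference of the relation with that variable doubled and \<open>2\<close> to the exponent in \<open>u\<close> times the
  original relation no longer contains \<open>u\<close>, and changes the coefficient of \<open>t\<close> by a factor that is
  nonzero in characteristic 0.\<close>
lemma monomials_independent: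
  assumes "finite K" and "\<And>c. (\<Sum>t\<in>K. s [:mon c t:] (x t)) = 0" and "t \<in> K"
  shows "x t = 0"
  using assms
proof (induction K arbitrary: x t rule: finite_induct)
  case (insert u K)
  have K: "x t = 0" if "t \<in> K" for t
  proof -
    from that insert.hyps have "t \<noteq> u" by blast
    then obtain i where i: "Poly_Mapping.lookup t i \<noteq> Poly_Mapping.lookup u i"
      by (meson poly_mapping_eqI)
    define e where "e v = (2 ^ Poly_Mapping.lookup v i - 2 ^ Poly_Mapping.lookup u i :: 'f)" for v
    have "(\<Sum>v\<in>K. s [:mon c v:] (s [:e v:] (x v))) = 0" for c
    proof -
      have "(\<Sum>v\<in>K. s [:mon c v:] (s [:e v:] (x v)))
        = (\<Sum>v\<in>insert u K. s [:mon c v:] (s [:e v:] (x v)))"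
        using insert.hyps by (simp add: e_def)
      also have "\<dots> = (\<Sum>v\<in>insert u K. s [:mon (c(i := 2 * c i)) v:] (x v))
          - s [:2 ^ Poly_Mapping.lookup u i:] (\<Sum>v\<in>insert u K. s [:mon c v:] (x v))"
        unfolding mon_upd scale_sum_right sum_subtractf[symmetric]
        by (intro sum.cong refl)
           (simp add: e_def scale_left_diff_distrib[symmetric] algebra_simps)
      finally show ?thesis by (simp only: insert.prems(1) scale_zero_right diff_0_right)
    qed
    from insert.IH[OF this \<open>t \<in> K\<close>] have 0: "s [:e t:] (x t) = 0" .
    have "e t \<noteq> 0"
    proof
      assume "e t = 0"
      then have "(of_nat (2 ^ Poly_Mapping.lookup t i) :: 'f) = of_nat (2 ^ Poly_Mapping.lookup u i)"
        by (simp add: e_def)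
      then show False using i unfolding of_nat_eq_iff by simp
    qed
    then have "x t = s ([:inverse (e t):] * [:e t:]) (x t)"
      by (simp add: one_pCons[symmetric])
    also have "\<dots> = 0"
      using 0 by (simp only: scale_scale[symmetric] scale_zero_right)
    finally show ?thesis .
  qed
  have "s [:mon (\<lambda>_. 1) u:] (x u) = 0"
    using insert.prems(1)[of "\<lambda>_. 1"] insert.hyps K by simp
  then have "x u = 0"
    by (simp add: mon_def one_pCons[symmetric])
  then show ?case
    using insert.prems(2) K by blast
qed simp

text \<open>Characteristic 0 lets identities between polynomials be checked on values.\<close>
lemma ev_eqI:
  assumes "\<And>c. ev s c p = ev s c p'" shows "p = p'"
proof -
  have "Poly_Mapping.lookup (p - p') t = 0" for t
  proof (cases "t \<in> Poly_Mapping.keys (p - p')")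
    case True
    have "(\<Sum>t\<in>Poly_Mapping.keys (p - p'). s [:mon c t:] (Poly_Mapping.lookup (p - p') t)) = 0" for c
      using ev_diff[of c p p'] assms[of c] by (simp add: ev_def)
    from monomials_independent[OF finite_keys this True] show ?thesis .
  qed (simp add: in_keys_iff)
  then have "p - p' = 0" by (intro poly_mapping_eqI) simp
  then show ?thesis by simp
qed

text \<open>A polynomial whose values depend only on the first \<open>q\<close> variables contains no others: setting the
  others to 0 does not change its values, hence not its coefficients.\<close>
lemma keys_boundI:
  assumes "\<And>c c'. (\<And>i. i < q \<Longrightarrow> c i = c' i) \<Longrightarrow> ev s c p = ev s c' p"
    and "t \<in> Poly_Mapping.keys p"
  shows "Poly_Mapping.keys t \<subseteq> {..<q}"
proof (rule ccontr)
  assume n: "\<not> Poly_Mapping.keys t \<subseteq> {..<q}"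
  define x where "x u = (if Poly_Mapping.keys u \<subseteq> {..<q} then 0 else Poly_Mapping.lookup p u)" for u
  have "(\<Sum>u\<in>Poly_Mapping.keys p. s [:mon c u:] (x u)) = 0" for c
  proof -
    define c0 where "c0 i = (if i < q then c i else 0)" for i
    have "ev s c p - ev s c0 p
      = (\<Sum>u\<in>Poly_Mapping.keys p. s [:mon c u - mon c0 u:] (Poly_Mapping.lookup p u))"
      by (simp add: ev_def sum_subtractf[symmetric] scale_left_diff_distrib[symmetric])
    also have "\<dots> = (\<Sum>u\<in>Poly_Mapping.keys p. s [:mon c u:] (x u))"
    proof (rule sum.cong)
      fix u
      show "s [:mon c u - mon c0 u:] (Poly_Mapping.lookup p u) = s [:mon c u:] (x u)"
      proof (cases "Poly_Mapping.keys u \<subseteq> {..<q}")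
        case True
        then have "mon c u = mon c0 u" by (intro mon_cong) (auto simp: c0_def)
        then show ?thesis using True by (simp add: x_def)
      next
        case False
        then obtain i where "i \<in> Poly_Mapping.keys u" "\<not> i < q" by auto
        then have "mon c0 u = 0"
          unfolding mon_def by (intro prod_zero) (auto simp: c0_def in_keys_iff intro!: bexI[of _ i])
        then show ?thesis using False by (simp add: x_def)
      qed
    qed simp
    finally show ?thesis using assms(1)[of c c0] by (simp add: c0_def)
  qed
  from monomials_independent[OF finite_keys this assms(2)] n assms(2) show False
    by (simp add: x_def in_keys_iff)
qed

lemma torsion_free:
  assumes "is_free s" "s r m = 0" "r \<noteq> 0" shows "m = 0"
proof -
  obtain Bs where Bs: "independent Bs" "span Bs = UNIV"
    using assms(1) by (auto simp: is_free_def is_basis_def)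
  have "representation Bs m b = 0" for b
    using representation_scale[OF Bs(1), of m r] assms(2,3) Bs
    by (simp add: representation_zero fun_eq_iff)
  then show ?thesis
    using sum_nonzero_representation_eq[OF Bs(1), of m] Bs(2) by simp
qed

end

interpretation ring: poly_module "(*) :: 'f::field_char_0 poly \<Rightarrow> 'f poly \<Rightarrow> 'f poly"
  by unfold_locales (simp_all add: algebra_simps)

lemma lscale_mult: "lscale (*) r p = r * p" for r p :: "'f::field_char_0 poly lpoly"
proof -
  have e: "(\<Sum>t\<in>Poly_Mapping.keys p. Poly_Mapping.single t (Poly_Mapping.lookup p t)) = p"
    for p :: "'f poly lpoly"
  proof (rule poly_mapping_eqI)
    fix k
    show "Poly_Mapping.lookup (\<Sum>t\<in>Poly_Mapping.keys p. Poly_Mapping.single t (Poly_Mapping.lookup p t)) k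
      = Poly_Mapping.lookup p k"
      by (simp add: lookup_sum lookup_single when_def sum.delta' in_keys_iff)
  qed
  have "lscale (*) r p = (\<Sum>u\<in>Poly_Mapping.keys r. Poly_Mapping.single u (Poly_Mapping.lookup r u))
     * (\<Sum>t\<in>Poly_Mapping.keys p. Poly_Mapping.single t (Poly_Mapping.lookup p t))"
    unfolding lscale_def sum_product mult_single ..
  then show ?thesis by (simp only: e)
qed

abbreviation evr :: "(nat \<Rightarrow> 'f::field_char_0) \<Rightarrow> 'f poly lpoly \<Rightarrow> 'f poly"
  where "evr \<equiv> ev (*)"

lemma evr_mult: "evr c (r * p) = evr c r * evr c p"
  using ring.ev_lscale[of c r p] by (simp add: lscale_mult)

lemma evr_of_int [simp]: "evr c (of_int k) = of_int k"
  by (simp only: single_of_int[symmetric] ring.ev_single) (simp add: one_pCons[symmetric])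

lemma evr_1 [simp]: "evr c 1 = 1"
  using evr_of_int[of c 1] by simp

lemma evr_power: "evr c (r ^ n) = evr c r ^ n"
  by (induction n) (simp_all add: evr_mult)

lemma evr_prod: "evr c (prod f I) = (\<Prod>i\<in>I. evr c (f i))"
  by (induction I rule: infinite_finite_induct) (simp_all add: evr_mult)

lemma evr_Lam [simp]: "evr c (Lam i) = [:c i:]"
  by (simp add: Lam_def)

lemma evr_Del [simp]: "evr c Del = del"
  by (simp add: Del_def one_pCons[symmetric])

context poly_module
begin

lemma ev_at_lam: "ev s c (at_lam s r p) = (\<Sum>n\<le>degree p. s (evr c r ^ n) (coeff p n))"
  by (simp add: at_lam_def ev_sum ev_lscale evr_power)

lemma ev_at_lam_const:
  assumes "evr c r = [:x:]" shows "ev s c (at_lam s r p) = pev s x p"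
  by (simp add: ev_at_lam assms pev_def poly_const_pow)

lemma ev_at_lams:
  assumes "\<And>t. t \<in> Poly_Mapping.keys p \<Longrightarrow> Poly_Mapping.keys t \<subseteq> {..<q}"
    and "\<And>i. i < q \<Longrightarrow> evr c (rs ! i) = [:c' i:]"
  shows "ev s c (at_lams s rs p) = ev s c' p"
proof -
  have "evr c (\<Prod>i\<in>Poly_Mapping.keys t. (rs ! i) ^ Poly_Mapping.lookup t i) = [:mon c' t:]"
    if "t \<in> Poly_Mapping.keys p" for t
  proof -
    have "(\<Prod>i\<in>Poly_Mapping.keys t. evr c (rs ! i) ^ Poly_Mapping.lookup t i)
      = (\<Prod>i\<in>Poly_Mapping.keys t. [:c' i ^ Poly_Mapping.lookup t i:])"
      using assms(1)[OF that] assms(2) by (intro prod.cong) (auto simp: poly_const_pow)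
    also have "\<dots> = [:\<Prod>i\<in>Poly_Mapping.keys t. c' i ^ Poly_Mapping.lookup t i:]"
      by (induction "Poly_Mapping.keys t" rule: infinite_finite_induct)
         (simp_all add: prod_to_poly)
    finally show ?thesis by (simp add: evr_prod evr_power mon_def)
  qed
  then show ?thesis
    by (simp add: at_lams_def ev_sum ev_lscale) (simp add: ev_def)
qed

lemma ev_lextend:
  fixes sX :: "'f poly \<Rightarrow> 'x::ab_group_add \<Rightarrow> 'x"
  assumes F: "\<And>x. ev s c (F x) = G x" and add: "\<And>x y. G (x + y) = G x + G y"
    and scale: "\<And>k x. G (sX [:k:] x) = s [:k:] (G x)"
  shows "ev s c (lextend s F p) = G (ev sX c p)"
proof -
  have 0: "G 0 = 0" using add[of 0 0] by simp
  have S: "G (sum f I) = (\<Sum>i\<in>I. G (f i))" for f and I :: "(nat \<Rightarrow>\<^sub>0 nat) set"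
    by (induction I rule: infinite_finite_induct) (simp_all add: add 0)
  show ?thesis
    unfolding ev_def[of sX] S scale
    by (simp add: lextend_def ev_sum ev_lscale F one_pCons[symmetric])
qed

end

text \<open>Compatibility with scalars and with \<open>\<partial>\<close> implies compatibility with all polynomials in \<open>\<partial>\<close>.  In
  the applications \<open>r\<close> is \<open>- c\<close> or \<open>\<partial> + c\<close>, the two sides of sesquilinearity at \<open>\<lambda> = c\<close>.\<close>
lemma poly_semilinear:
  fixes s :: "'f::field_char_0 poly \<Rightarrow> 'm::ab_group_add \<Rightarrow> 'm"
    and t :: "'f poly \<Rightarrow> 'n::ab_group_add \<Rightarrow> 'n"
  assumes "module s" "module t"
    and add: "\<And>a b. g (a + b) = g a + g b"
    and scale: "\<And>k a. g (s [:k:] a) = t [:k:] (g a)"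
    and del: "\<And>a. g (s del a) = t r (g a)"
  shows "g (s p a) = t (pcompose p r) (g a)"
proof -
  interpret s: module s by fact
  interpret t: module t by fact
  show ?thesis
  proof (induction p)
    case 0
    then show ?case using add[of 0 0] by simp
  next
    case (pCons k p)
    have "pCons k p = [:k:] + del * p" by simp
    then have "s (pCons k p) a = s [:k:] a + s del (s p a)"
      by (simp only: s.scale_left_distrib s.scale_scale)
    then show ?case
      by (simp add: add scale del pCons.IH pcompose_pCons t.scale_left_distrib
          t.scale_scale[symmetric] del: t.scale_scale s.scale_scale)
  qed
qed

lemma pcompose_const: "pcompose p [:x:] = [:poly p x:]"
  by (induction p) (simp_all add: pcompose_pCons mult.commute)

section \<open>Cartan calculus for evaluated cochains\<close>

text \<open>The structure that remains of a Lie conformal algebra and a module when every \<open>\<lambda>\<close> is given a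
  value.  A pair \<open>(a, c)\<close> stands for \<open>a\<close> with its variable set to \<open>c\<close>; it is a homogeneous element of
  degree \<open>c\<close> in the Lie algebra graded by the field whose part of degree \<open>c\<close> is the quotient of the algebra
  by \<open>\<partial> + c\<close>.  Passing to the quotient is avoided: multilinear functions do not see the difference
  between \<open>\<partial> a\<close> and \<open>- c a\<close>, and skew-symmetry of the bracket is only asked for under functions \<open>g\<close>
  with that property.\<close>
locale evaluated_lca = A: module sA + M: module sM
  for sA :: "'f::field poly \<Rightarrow> 'a::ab_group_add \<Rightarrow> 'a"
    and sM :: "'f poly \<Rightarrow> 'm::ab_group_add \<Rightarrow> 'm" +
  fixes B :: "'a \<times> 'f \<Rightarrow> 'a \<times> 'f \<Rightarrow> 'a" and ac :: "'a \<times> 'f \<Rightarrow> 'm \<Rightarrow> 'm"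
  assumes ac_add: "ac z (m + n) = ac z m + ac z n"
    and ac_scale: "ac z (sM [:k:] m) = sM [:k:] (ac z m)"
    and ac_add_left: "ac (a + b, c) m = ac (a, c) m + ac (b, c) m"
    and ac_scale_left: "ac (sA p a, c) m = sM [:poly p (- c):] (ac (a, c) m)"
    and ac_bracket: "ac (B z w, snd z + snd w) m = ac z (ac w m) - ac w (ac z m)"
    and B_add_left: "B (a + b, c) w = B (a, c) w + B (b, c) w"
    and B_add_right: "B z (a + b, c) = B z (a, c) + B z (b, c)"
    and B_scale_left: "B (sA p a, c) w = sA [:poly p (- c):] (B (a, c) w)"
    and B_scale_right: "B z (sA p a, c) = sA (pcompose p [:snd z, 1:]) (B z (a, c))"
    and B_skew: "(\<And>a b. g (a + b) = g a + g b) \<Longrightarrow>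
      (\<And>p a. g (sA p a) = sM [:poly p (- (snd z + snd w)):] (g a)) \<Longrightarrow> g (B z w) = - g (B w z)"
    and B_jacobi: "B z (B w x, snd w + snd x)
      = B (B z w, snd z + snd w) x + B w (B z x, snd z + snd x)"
begin

definition bracket :: "'a \<times> 'f \<Rightarrow> 'a \<times> 'f \<Rightarrow> 'a \<times> 'f"
  where "bracket z w = (B z w, snd z + snd w)"

lemma snd_bracket [simp]: "snd (bracket z w) = snd z + snd w"
  by (simp add: bracket_def)

text \<open>Linearity over polynomials in \<open>\<partial>\<close>, where \<open>\<partial>\<close> acts on an argument of degree \<open>c\<close> by \<open>- c\<close>.\<close>
definition mlin :: "(('a \<times> 'f) list \<Rightarrow> 'm) \<Rightarrow> bool"
  where "mlin \<phi> \<longleftrightarrow> (\<forall>xs ys c.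
    (\<forall>a b. \<phi> (xs @ (a + b, c) # ys) = \<phi> (xs @ (a, c) # ys) + \<phi> (xs @ (b, c) # ys)) \<and>
    (\<forall>p a. \<phi> (xs @ (sA p a, c) # ys) = sM [:poly p (- c):] (\<phi> (xs @ (a, c) # ys))))"

definition alt :: "(('a \<times> 'f) list \<Rightarrow> 'm) \<Rightarrow> bool"
  where "alt \<phi> \<longleftrightarrow> (\<forall>xs z w ys. \<phi> (xs @ z # w # ys) = - \<phi> (xs @ w # z # ys))"

text \<open>The Lie derivative along \<open>z\<close> and the Chevalley-Eilenberg differential, defined by recursion on
  the arguments.  The recursive equations are \<open>\<iota>\<^sub>w \<theta>\<^sub>z = \<theta>\<^sub>z \<iota>\<^sub>w - \<iota>\<^bsub>[z, w]\<^esub>\<close> and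
  Cartan's formula \<open>\<iota>\<^sub>z D = \<theta>\<^sub>z - D \<iota>\<^sub>z\<close>, where \<open>\<iota>\<^sub>z\<close> inserts \<open>z\<close> as the first argument.  With them
  the identities of Cartan calculus follow by induction on the list of arguments, without any
  manipulation of alternating double sums.\<close>
fun theta :: "'a \<times> 'f \<Rightarrow> (('a \<times> 'f) list \<Rightarrow> 'm) \<Rightarrow> ('a \<times> 'f) list \<Rightarrow> 'm"
  where
    "theta z \<phi> [] = ac z (\<phi> [])"
  | "theta z \<phi> (w # ws) = theta z (\<lambda>v. \<phi> (w # v)) ws - \<phi> (bracket z w # ws)"

fun D :: "(('a \<times> 'f) list \<Rightarrow> 'm) \<Rightarrow> ('a \<times> 'f) list \<Rightarrow> 'm"
  where
    "D \<phi> [] = 0"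
  | "D \<phi> (z # zs) = theta z \<phi> zs - D (\<lambda>v. \<phi> (z # v)) zs"

lemma mlin_add: "mlin \<phi> \<Longrightarrow> \<phi> (xs @ (a + b, c) # ys) = \<phi> (xs @ (a, c) # ys) + \<phi> (xs @ (b, c) # ys)"
  and mlin_scale: "mlin \<phi> \<Longrightarrow> \<phi> (xs @ (sA p a, c) # ys) = sM [:poly p (- c):] (\<phi> (xs @ (a, c) # ys))"
  and alt_swap: "alt \<phi> \<Longrightarrow> \<phi> (xs @ z # w # ys) = - \<phi> (xs @ w # z # ys)"
  unfolding mlin_def alt_def by blast+

lemma mlin_add_Cons: "mlin \<phi> \<Longrightarrow> \<phi> ((a + b, c) # ys) = \<phi> ((a, c) # ys) + \<phi> ((b, c) # ys)"
  and mlin_scale_Cons: "mlin \<phi> \<Longrightarrow> \<phi> ((sA p a, c) # ys) = sM [:poly p (- c):] (\<phi> ((a, c) # ys))"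
  and alt_swap_Cons: "alt \<phi> \<Longrightarrow> \<phi> (z # w # ys) = - \<phi> (w # z # ys)"
  by (fact mlin_add[of \<phi> "[]", simplified append_Nil],
      fact mlin_scale[of \<phi> "[]", simplified append_Nil],
      fact alt_swap[of \<phi> "[]", simplified append_Nil])

lemma mlin_Cons: "mlin \<phi> \<Longrightarrow> mlin (\<lambda>v. \<phi> (z # v))"
  unfolding mlin_def append_Cons[symmetric] by blast

lemma alt_Cons: "alt \<phi> \<Longrightarrow> alt (\<lambda>v. \<phi> (z # v))"
  unfolding alt_def append_Cons[symmetric] by blast

lemma mlin_plus: "mlin \<phi> \<Longrightarrow> mlin \<psi> \<Longrightarrow> mlin (\<lambda>v. \<phi> v + \<psi> v)"
  unfolding mlin_def by (simp add: M.scale_right_distrib)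
lemma alt_plus: "alt \<phi> \<Longrightarrow> alt \<psi> \<Longrightarrow> alt (\<lambda>v. \<phi> v + \<psi> v)"
  unfolding alt_def by (metis minus_add_distrib)
lemma mlin_const_scale: "mlin \<phi> \<Longrightarrow> mlin (\<lambda>v. sM [:k:] (\<phi> v))"
  unfolding mlin_def by (simp add: M.scale_right_distrib mult.commute)
lemma alt_const_scale: "alt \<phi> \<Longrightarrow> alt (\<lambda>v. sM [:k:] (\<phi> v))"
  unfolding alt_def by (metis M.scale_minus_right)

lemma ac_0 [simp]: "ac z 0 = 0"
  using ac_add[of z 0 0] by simp
lemma ac_uminus: "ac z (- m) = - ac z m"
  using ac_add[of z m "- m"] by (simp add: add_eq_0_iff)
lemma ac_diff: "ac z (m - n) = ac z m - ac z n"
  using ac_add[of z m "- n"] by (simp add: ac_uminus)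

lemma theta_add: "theta z (\<lambda>v. \<phi> v + \<psi> v) zs = theta z \<phi> zs + theta z \<psi> zs"
  by (induction zs arbitrary: \<phi> \<psi>) (auto simp: ac_add)
lemma theta_diff: "theta z (\<lambda>v. \<phi> v - \<psi> v) zs = theta z \<phi> zs - theta z \<psi> zs"
  by (induction zs arbitrary: \<phi> \<psi>) (auto simp: ac_diff)
lemma theta_uminus: "theta z (\<lambda>v. - \<phi> v) zs = - theta z \<phi> zs"
  by (induction zs arbitrary: \<phi>) (auto simp: ac_uminus)
lemma theta_scale: "theta z (\<lambda>v. sM [:k:] (\<phi> v)) zs = sM [:k:] (theta z \<phi> zs)"
  by (induction zs arbitrary: \<phi>) (auto simp: ac_scale M.scale_right_diff_distrib)

lemma D_add: "D (\<lambda>v. \<phi> v + \<psi> v) zs = D \<phi> zs + D \<psi> zs"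
  by (induction zs arbitrary: \<phi> \<psi>) (auto simp: theta_add)
lemma D_diff: "D (\<lambda>v. \<phi> v - \<psi> v) zs = D \<phi> zs - D \<psi> zs"
  by (induction zs arbitrary: \<phi> \<psi>) (auto simp: theta_diff)
lemma D_uminus: "D (\<lambda>v. - \<phi> v) zs = - D \<phi> zs"
  by (induction zs arbitrary: \<phi>) (auto simp: theta_uminus)
lemma D_scale: "D (\<lambda>v. sM [:k:] (\<phi> v)) zs = sM [:k:] (D \<phi> zs)"
  by (induction zs arbitrary: \<phi>) (auto simp: theta_scale M.scale_right_diff_distrib)

lemma theta_add_left: "mlin \<phi> \<Longrightarrow> theta (a + b, c) \<phi> zs = theta (a, c) \<phi> zs + theta (b, c) \<phi> zs"
proof (induction zs arbitrary: \<phi>)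
  case (Cons w ws)
  then show ?case
    using Cons.IH[OF mlin_Cons[OF Cons.prems]]
    by (simp add: bracket_def B_add_left mlin_add_Cons)
qed (simp add: ac_add_left)

lemma theta_scale_left:
  "mlin \<phi> \<Longrightarrow> theta (sA p a, c) \<phi> zs = sM [:poly p (- c):] (theta (a, c) \<phi> zs)"
proof (induction zs arbitrary: \<phi>)
  case (Cons w ws)
  then show ?case
    using Cons.IH[OF mlin_Cons[OF Cons.prems]]
    by (simp add: bracket_def B_scale_left mlin_scale_Cons M.scale_right_diff_distrib)
qed (simp add: ac_scale_left)

lemma mlin_theta:
  assumes "mlin \<phi>" shows "mlin (theta z \<phi>)"
proof -
  have "theta z \<phi> (xs @ (a + b, c) # ys) = theta z \<phi> (xs @ (a, c) # ys) + theta z \<phi> (xs @ (b, c) # ys)"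
    and "theta z \<phi> (xs @ (sA p a, c) # ys) = sM [:poly p (- c):] (theta z \<phi> (xs @ (a, c) # ys))"
    for xs a b c ys p
    using assms
  proof (induction xs arbitrary: \<phi>)
    case Nil
    { case 1 then show ?case
        by (simp add: bracket_def B_add_right mlin_add_Cons theta_add) }
    { case 2 then show ?case
        by (simp add: bracket_def B_scale_right mlin_scale_Cons theta_scale poly_pcompose
            M.scale_right_diff_distrib) }
  next
    case (Cons x xs)
    { case 1 then show ?case
        using mlin_add[OF 1, of "_ # _"] Cons(1)[OF mlin_Cons[OF 1]] by simp }
    { case 2 then show ?case
        using mlin_scale[OF 2, of "_ # _"] Cons(2)[OF mlin_Cons[OF 2]]
        by (simp add: M.scale_right_diff_distrib) }
  qed
  then show ?thesis
    unfolding mlin_def by blast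
qed

lemma mlin_D:
  assumes "mlin \<phi>" shows "mlin (D \<phi>)"
proof -
  have "D \<phi> (xs @ (a + b, c) # ys) = D \<phi> (xs @ (a, c) # ys) + D \<phi> (xs @ (b, c) # ys)"
    and "D \<phi> (xs @ (sA p a, c) # ys) = sM [:poly p (- c):] (D \<phi> (xs @ (a, c) # ys))"
    for xs a b c ys p
    using assms
  proof (induction xs arbitrary: \<phi>)
    case Nil
    { case 1 then show ?case
        by (simp add: theta_add_left mlin_add_Cons D_add) }
    { case 2 then show ?case
        by (simp add: theta_scale_left mlin_scale_Cons D_scale M.scale_right_diff_distrib) }
  next
    case (Cons x xs)
    { case 1 then show ?case
        using mlin_add[OF mlin_theta[OF 1]] Cons(1)[OF mlin_Cons[OF 1]] by simp }
    { case 2 then show ?case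
        using mlin_scale[OF mlin_theta[OF 2]] Cons(2)[OF mlin_Cons[OF 2]]
        by (simp add: M.scale_right_diff_distrib) }
  qed
  then show ?thesis
    unfolding mlin_def by blast
qed

lemma mlin_bracket_skew:
  assumes "mlin \<phi>" shows "\<phi> (xs @ bracket z w # ys) = - \<phi> (xs @ bracket w z # ys)"
  using B_skew[of "\<lambda>a. \<phi> (xs @ (a, snd z + snd w) # ys)" z w]
  by (simp add: bracket_def mlin_add[OF assms] mlin_scale[OF assms] add.commute)

lemma alt_theta:
  assumes "alt \<phi>" shows "alt (theta z \<phi>)"
proof -
  have "theta z \<phi> (xs @ v # w # ys) = - theta z \<phi> (xs @ w # v # ys)" for xs v w ys
    using assms
  proof (induction xs arbitrary: \<phi>)
    case Nil
    have "(\<lambda>u. \<phi> (v # w # u)) = (\<lambda>u. - \<phi> (w # v # u))"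
      by (rule ext) (rule alt_swap_Cons[OF Nil])
    then have "theta z (\<lambda>u. \<phi> (v # w # u)) ys = - theta z (\<lambda>u. \<phi> (w # v # u)) ys"
      by (simp add: theta_uminus)
    then show ?case
      using alt_swap_Cons[OF Nil, of v "bracket z w" ys] alt_swap_Cons[OF Nil, of w "bracket z v" ys] by simp
  next
    case (Cons x xs)
    then show ?case
      using alt_swap[OF Cons.prems, of "bracket z x # xs" v w ys] Cons.IH[OF alt_Cons[OF Cons.prems]] by simp
  qed
  then show ?thesis
    unfolding alt_def by blast
qed

text \<open>Two contractions of Cartan's formula give
  \<open>\<iota>\<^sub>w \<iota>\<^sub>v D = \<theta>\<^sub>v \<iota>\<^sub>w - \<theta>\<^sub>w \<iota>\<^sub>v - \<iota>\<^bsub>[v, w]\<^esub> + D \<iota>\<^sub>w \<iota>\<^sub>v\<close>, which changes sign when \<open>v\<close> and \<open>w\<close> are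
  exchanged.\<close>
lemma D_swap:
  assumes "mlin \<phi>" "alt \<phi>" shows "D \<phi> (v # w # ys) = - D \<phi> (w # v # ys)"
proof -
  have "(\<lambda>u. \<phi> (v # w # u)) = (\<lambda>u. - \<phi> (w # v # u))"
    by (rule ext) (rule alt_swap_Cons[OF assms(2)])
  then have "D (\<lambda>u. \<phi> (v # w # u)) ys = - D (\<lambda>u. \<phi> (w # v # u)) ys"
    by (simp add: D_uminus)
  then show ?thesis
    using mlin_bracket_skew[OF assms(1), of "[]" v w ys] by simp
qed

lemma alt_D:
  assumes "mlin \<phi>" "alt \<phi>" shows "alt (D \<phi>)"
proof -
  have "D \<phi> (xs @ v # w # ys) = - D \<phi> (xs @ w # v # ys)" for xs v w ys
    using assms
  proof (induction xs arbitrary: \<phi>)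
    case Nil
    then show ?case using D_swap[OF Nil] by simp
  next
    case (Cons x xs)
    then show ?case
      using alt_swap[OF alt_theta[OF Cons.prems(2)], of x xs v w ys]
        Cons.IH[OF mlin_Cons[OF Cons.prems(1)] alt_Cons[OF Cons.prems(2)]] by simp
  qed
  then show ?thesis
    unfolding alt_def by blast
qed

text \<open>In the empty list this is the module axiom; each further argument contributes a Jacobi identity.\<close>
lemma theta_commutator:
  "mlin \<phi> \<Longrightarrow> theta (bracket z w) \<phi> zs = theta z (theta w \<phi>) zs - theta w (theta z \<phi>) zs"
proof (induction zs arbitrary: \<phi>)
  case Nil
  then show ?case by (simp add: bracket_def ac_bracket)
next
  case (Cons x xs)
  have "bracket z (bracket w x) = (B (bracket z w) x + B w (bracket z x), snd z + snd w + snd x)"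
    using B_jacobi[of z w x] by (simp add: bracket_def add.assoc)
  then have "\<phi> (bracket z (bracket w x) # xs) = \<phi> (bracket (bracket z w) x # xs) + \<phi> (bracket w (bracket z x) # xs)"
    using mlin_add_Cons[OF Cons.prems, of "B (bracket z w) x" "B w (bracket z x)" "snd z + snd w + snd x" xs]
    by (simp add: bracket_def add_ac)
  then show ?case
    using Cons.IH[OF mlin_Cons[OF Cons.prems]]
    by (simp add: theta_diff algebra_simps)
qed

lemma theta_D_commute: "mlin \<phi> \<Longrightarrow> theta z (D \<phi>) zs = D (theta z \<phi>) zs"
proof (induction zs arbitrary: \<phi>)
  case (Cons w ws)
  then show ?case
    using Cons.IH[OF mlin_Cons[OF Cons.prems]] theta_commutator[OF Cons.prems, of z w ws]
    by (simp add: theta_diff D_diff)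
qed simp

text \<open>By Cartan's formula \<open>\<iota>\<^sub>z D D = \<theta>\<^sub>z D - D \<theta>\<^sub>z + D D \<iota>\<^sub>z\<close>.\<close>
lemma D_D: "mlin \<phi> \<Longrightarrow> D (D \<phi>) zs = 0"
proof (induction zs arbitrary: \<phi>)
  case (Cons z zs)
  then show ?case
    using Cons.IH[OF mlin_Cons[OF Cons.prems]] theta_D_commute[OF Cons.prems, of z zs]
    by (simp add: D_diff)
qed simp

lemma theta_expand:
  "theta z \<phi> zs = ac z (\<phi> zs) - (\<Sum>i<length zs. \<phi> (zs[i := bracket z (zs ! i)]))"
  by (induction zs arbitrary: \<phi>) (simp_all add: sum.lessThan_Suc_shift del: sum.lessThan_Suc)

text \<open>The usual closed formula for the differential.\<close>
definition diff_formula :: "(('a \<times> 'f) list \<Rightarrow> 'm) \<Rightarrow> ('a \<times> 'f) list \<Rightarrow> 'm"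
  where "diff_formula \<phi> zs = (\<Sum>k<length zs. sM ((- 1) ^ k) (ac (zs ! k) (\<phi> (nths zs (- {k})))))
    + (\<Sum>l<length zs. \<Sum>k<l. sM ((- 1) ^ (k + l))
        (\<phi> (bracket (zs ! k) (zs ! l) # nths zs (- {k, l}))))"

lemma alt_move: "alt \<phi> \<Longrightarrow> \<phi> (xs @ z # ys) = sM ((- 1) ^ length xs) (\<phi> (z # xs @ ys))"
proof (induction xs arbitrary: \<phi>)
  case (Cons x xs)
  then show ?case
    using Cons.IH[OF alt_Cons[OF Cons.prems], of x] alt_swap_Cons[OF Cons.prems, of x z "xs @ ys"]
    by simp
qed simp

lemma nths_compl_0: "nths (z # zs) (- {0}) = zs"
  by (simp add: nths_Cons nths_all)
lemma nths_compl_Suc: "nths (z # zs) (- {Suc k}) = z # nths zs (- {k})"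
  by (simp add: nths_Cons Compl_eq)
lemma nths_compl_0_Suc: "nths (z # zs) (- {0, Suc l}) = nths zs (- {l})"
  by (simp add: nths_Cons Compl_eq)
lemma nths_compl_Suc_Suc: "nths (z # zs) (- {Suc k, Suc l}) = z # nths zs (- {k, l})"
  by (simp add: nths_Cons Compl_eq)

lemma nths_compl_single: "i < length zs \<Longrightarrow> nths zs (- {i}) = take i zs @ drop (Suc i) zs"
proof (induction zs arbitrary: i)
  case (Cons z zs)
  then show ?case by (cases i) (auto simp: nths_compl_0 nths_compl_Suc)
qed simp

text \<open>The terms of the closed formula that treat the first argument \<open>z\<close> separately from the others
  form \<open>\<theta>\<^sub>z\<close>, once each bracket has been moved from the front to the place of its second factor; the
  remaining terms form \<open>- D \<iota>\<^sub>z\<close>.\<close>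
lemma diff_formula_eq_D: "alt \<phi> \<Longrightarrow> diff_formula \<phi> zs = D \<phi> zs"
proof (induction zs arbitrary: \<phi>)
  case Nil
  then show ?case by (simp add: diff_formula_def)
next
  case (Cons z zs)
  have b: "\<phi> (zs[l := bracket z (zs ! l)]) = sM ((- 1) ^ l) (\<phi> (bracket z (zs ! l) # nths zs (- {l})))"
    if "l < length zs" for l
    using that alt_move[OF Cons.prems, of "take l zs"]
    by (simp add: upd_conv_take_nth_drop nths_compl_single)
  have s: "\<phi> (bracket (zs ! k) (zs ! l) # z # nths zs (- {k, l}))
     = - \<phi> (z # bracket (zs ! k) (zs ! l) # nths zs (- {k, l}))" for k l
    by (rule alt_swap_Cons[OF Cons.prems])
  have 1: "(\<Sum>k<length (z # zs). sM ((- 1) ^ k) (ac ((z # zs) ! k) (\<phi> (nths (z # zs) (- {k})))))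
    = ac z (\<phi> zs) - (\<Sum>k<length zs. sM ((- 1) ^ k) (ac (zs ! k) (\<phi> (z # nths zs (- {k})))))"
    by (simp add: sum.lessThan_Suc_shift nths_compl_0 nths_compl_Suc sum_negf del: sum.lessThan_Suc)
  have 2: "(\<Sum>l<length (z # zs). \<Sum>k<l. sM ((- 1) ^ (k + l))
        (\<phi> (bracket ((z # zs) ! k) ((z # zs) ! l) # nths (z # zs) (- {k, l}))))
     = (\<Sum>l<length zs. - \<phi> (zs[l := bracket z (zs ! l)])) - (\<Sum>l<length zs. \<Sum>k<l. sM ((- 1) ^ (k + l))
        (\<phi> (z # bracket (zs ! k) (zs ! l) # nths zs (- {k, l}))))"
    by (simp add: sum.lessThan_Suc_shift nths_compl_0_Suc nths_compl_Suc_Suc b s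
         sum_negf sum.distrib sum_subtractf del: sum.lessThan_Suc)
  show ?case
    using Cons.IH[OF alt_Cons[OF Cons.prems], of z]
    unfolding diff_formula_def 1 2 by (simp add: diff_formula_def theta_expand sum_negf algebra_simps)
qed

text \<open>For \<open>z = (L, 0)\<close> the Lie derivative is the action of \<open>\<partial>\<close> on cochains: \<open>z\<close> acts by \<open>\<partial>\<close> on \<open>M\<close>, and
  \<open>[z, (a, c)] = (\<partial> a, c)\<close> contributes \<open>- c\<close>.\<close>
lemma theta_virasoro:
  assumes "mlin \<phi>" and "\<And>m. ac z m = sM del m" and "\<And>a c. B z (a, c) = sA del a" "snd z = 0"
  shows "theta z \<phi> zs = sM (del + [:sum_list (map snd zs):]) (\<phi> zs)"
  using assms(1)
proof (induction zs arbitrary: \<phi>)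
  case (Cons w ws)
  have "\<phi> (bracket z w # ws) = sM [:- snd w:] (\<phi> (w # ws))"
    using mlin_scale_Cons[OF Cons.prems, of del "fst w" "snd w" ws] assms(3)[of "fst w" "snd w"] assms(4)
    by (simp add: bracket_def)
  then show ?case
    using Cons.IH[OF mlin_Cons[OF Cons.prems]]
    by (simp add: M.scale_left_diff_distrib[symmetric] add.commute)
qed (simp add: assms)

lemma theta_support: "(\<And>v. length v \<noteq> q \<Longrightarrow> \<phi> v = 0) \<Longrightarrow> length zs \<noteq> q \<Longrightarrow> theta z \<phi> zs = 0"
  by (simp add: theta_expand)

lemma D_support: "(\<And>v. length v \<noteq> q \<Longrightarrow> \<phi> v = 0) \<Longrightarrow> length zs \<noteq> Suc q \<Longrightarrow> D \<phi> zs = 0"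
proof (induction zs arbitrary: \<phi> q)
  case (Cons z zs)
  have "theta z \<phi> zs = 0" using Cons.prems by (intro theta_support[of q]) simp_all
  moreover have "D (\<lambda>v. \<phi> (z # v)) zs = 0"
    \<comment> \<open>If \<open>q = 0\<close> then the contracted function vanishes on all lists, and \<open>length zs\<close> serves as its length.\<close>
    using Cons.prems by (intro Cons.IH[of "if q = 0 then length zs else q - 1"]) (auto split: if_splits)
  ultimately show ?case by simp
qed simp

end

section \<open>Evaluation of a Lie conformal algebra and its cochains\<close>

text \<open>A module over a Lie conformal algebra, evaluated: \<open>B z w\<close> and \<open>ac z m\<close> are the \<open>\<lambda>\<close>-bracket and the
  \<open>\<lambda>\<close>-action with \<open>\<lambda>\<close> set to the second component of \<open>z\<close>.\<close>
locale lca_module_char_0 = lca_module sA br sM act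
  for sA :: "'f::field_char_0 poly \<Rightarrow> 'a::ab_group_add \<Rightarrow> 'a"
    and br :: "'a \<Rightarrow> 'a \<Rightarrow> 'a poly"
    and sM :: "'f poly \<Rightarrow> 'm::ab_group_add \<Rightarrow> 'm"
    and act :: "'a \<Rightarrow> 'm \<Rightarrow> 'm poly"
begin

sublocale PA: poly_module sA ..
sublocale PM: poly_module sM ..

definition B :: "'a \<times> 'f \<Rightarrow> 'a \<times> 'f \<Rightarrow> 'a"
  where "B z w = pev sA (snd z) (br (fst z) (fst w))"

definition ac :: "'a \<times> 'f \<Rightarrow> 'm \<Rightarrow> 'm"
  where "ac z m = pev sM (snd z) (act (fst z) m)"

lemma ev_act: "evr c r = [:x:] \<Longrightarrow> ev sM c (at_lam sM r (act a m)) = ac (a, x) m"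
  by (simp add: PM.ev_at_lam_const ac_def)

lemma ac_add_right: "ac z (m + n) = ac z m + ac z n"
  by (simp add: ac_def act_add_right PM.pev_add)

lemma ac_scale_right: "ac z (sM [:k:] m) = sM [:k:] (ac z m)"
  by (simp add: ac_def act_scale_right PM.pev_map_poly)

lemma ac_linear_left:
  shows "ac (a + b, c) m = ac (a, c) m + ac (b, c) m"
    and "ac (sA p a, c) m = sM [:poly p (- c):] (ac (a, c) m)"
proof -
  show add: "ac (a + b, c) m = ac (a, c) m + ac (b, c) m" for a b
    by (simp add: ac_def act_add_left PM.pev_add)
  have del: "ac (sA del a, c) m = sM [:- c:] (ac (a, c) m)" for a
    using arg_cong[OF act_del_left[of a m], of "ev sM (\<lambda>_. c)"]
    by (simp add: PM.ev_lscale ev_act ring.ev_uminus)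
  show "ac (sA p a, c) m = sM [:poly p (- c):] (ac (a, c) m)"
    unfolding pcompose_const[symmetric]
    by (rule poly_semilinear[of sA sM "\<lambda>a. ac (a, c) m", OF module_axioms M.module_axioms add _ del])
       (simp add: ac_def act_scale_left PM.pev_map_poly)
qed

lemma B_linear_left:
  shows "B (a + b, c) w = B (a, c) w + B (b, c) w"
    and "B (sA p a, c) w = sA [:poly p (- c):] (B (a, c) w)"
proof -
  show add: "B (a + b, c) w = B (a, c) w + B (b, c) w" for a b
    by (simp add: B_def br_add_left PA.pev_add)
  have del: "B (sA del a, c) w = sA [:- c:] (B (a, c) w)" for a
    using arg_cong[OF br_del_left[of a "fst w"], of "ev sA (\<lambda>_. c)"]
    by (simp add: PA.ev_lscale PA.ev_at_lam_const B_def ring.ev_uminus)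
  show "B (sA p a, c) w = sA [:poly p (- c):] (B (a, c) w)"
    unfolding pcompose_const[symmetric]
    by (rule poly_semilinear[of sA sA "\<lambda>a. B (a, c) w", OF module_axioms module_axioms add _ del])
       (simp add: B_def br_scale_left PA.pev_map_poly)
qed

lemma B_linear_right:
  shows "B z (a + b, c) = B z (a, c) + B z (b, c)"
    and "B z (sA p a, c) = sA (pcompose p [:snd z, 1:]) (B z (a, c))"
proof -
  show add: "B z (a + b, c) = B z (a, c) + B z (b, c)" for a b
    by (simp add: B_def br_add_right PA.pev_add)
  have del: "B z (sA del a, c) = sA [:snd z, 1:] (B z (a, c))" for a
    using arg_cong[OF br_del_right[of "fst z" a], of "ev sA (\<lambda>_. snd z)"]
    by (simp add: PA.ev_lscale PA.ev_at_lam_const B_def ring.ev_add)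
  show "B z (sA p a, c) = sA (pcompose p [:snd z, 1:]) (B z (a, c))"
    by (rule poly_semilinear[of sA sA "\<lambda>a. B z (a, c)", OF module_axioms module_axioms add _ del])
       (simp add: B_def br_scale_right PA.pev_map_poly)
qed

lemma ac_B: "ac (B z w, snd z + snd w) m = ac z (ac w m) - ac w (ac z m)"
proof -
  define c where "c i = (if i = 0 then snd z else snd w)" for i :: nat
  have c: "c 0 = snd z" "c 1 = snd w" "c (Suc 0) = snd w" by (simp_all add: c_def)
  have "ev sM c (lextend sM (\<lambda>n. at_lam sM (Lam 0) (act (fst z) n)) (at_lam sM (Lam 1) (act (fst w) m)))
      = ac z (ac w m)"
    by (subst PM.ev_lextend[where G = "ac z" and sX = sM])
       (simp_all add: ev_act c ac_add_right ac_scale_right)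
  moreover have "ev sM c (lextend sM (\<lambda>n. at_lam sM (Lam 1) (act (fst w) n)) (at_lam sM (Lam 0) (act (fst z) m)))
      = ac w (ac z m)"
    by (subst PM.ev_lextend[where G = "ac w" and sX = sM])
       (simp_all add: ev_act c ac_add_right ac_scale_right)
  moreover have "ev sM c (lextend sM (\<lambda>x. at_lam sM (Lam 0 + Lam 1) (act x m))
      (at_lam sA (Lam 0) (br (fst z) (fst w)))) = ac (B z w, snd z + snd w) m"
    by (subst PM.ev_lextend[where G = "\<lambda>x. ac (x, snd z + snd w) m" and sX = sA])
       (simp_all add: ev_act ring.ev_add c ac_linear_left PA.ev_at_lam_const B_def)
  ultimately show ?thesis
    using arg_cong[OF act_br[of "fst z" "fst w" m], of "ev sM c"] by (simp add: PM.ev_diff)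
qed

lemma B_B: "B z (B w x, snd w + snd x) = B (B z w, snd z + snd w) x + B w (B z x, snd z + snd x)"
proof -
  define c where "c i = (if i = 0 then snd z else snd w)" for i :: nat
  have c: "c 0 = snd z" "c 1 = snd w" "c (Suc 0) = snd w" by (simp_all add: c_def)
  have snd: "B u (a, y) = B u (a, 0)" for u a y by (simp add: B_def)
  have "ev sA c (lextend sA (\<lambda>n. at_lam sA (Lam 0) (br (fst z) n)) (at_lam sA (Lam 1) (br (fst w) (fst x))))
      = B z (B w x, 0)"
    by (subst PA.ev_lextend[where G = "\<lambda>n. B z (n, 0)" and sX = sA])
       (simp_all add: PA.ev_at_lam_const c B_def br_add_right PA.pev_add br_scale_right PA.pev_map_poly)
  moreover have "ev sA c (lextend sA (\<lambda>n. at_lam sA (Lam 1) (br (fst w) n)) (at_lam sA (Lam 0) (br (fst z) (fst x))))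
      = B w (B z x, 0)"
    by (subst PA.ev_lextend[where G = "\<lambda>n. B w (n, 0)" and sX = sA])
       (simp_all add: PA.ev_at_lam_const c B_def br_add_right PA.pev_add br_scale_right PA.pev_map_poly)
  moreover have "ev sA c (lextend sA (\<lambda>n. at_lam sA (Lam 0 + Lam 1) (br n (fst x)))
      (at_lam sA (Lam 0) (br (fst z) (fst w)))) = B (B z w, snd z + snd w) x"
    by (subst PA.ev_lextend[where G = "\<lambda>n. B (n, snd z + snd w) x" and sX = sA])
       (simp_all add: ring.ev_add PA.ev_at_lam_const c B_def br_add_left PA.pev_add br_scale_left
          PA.pev_map_poly)
  ultimately show ?thesis
    using arg_cong[OF br_jacobi[of "fst z" "fst w" "fst x"], of "ev sA c"]
      snd[of z _ "snd w + snd x"] snd[of w _ "snd z + snd x"] by (simp add: PA.ev_add)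
qed

text \<open>Under \<open>g\<close> the operator \<open>\<partial>\<close> becomes \<open>- (c + d)\<close>, where \<open>c\<close> and \<open>d\<close> are the degrees of \<open>z\<close> and \<open>w\<close>.
  So the substitution of \<open>- \<lambda> - \<partial>\<close> at \<open>\<lambda> = c\<close> becomes that of \<open>d\<close>.\<close>
lemma B_skew_sym:
  assumes add: "\<And>a b. g (a + b) = g a + g b"
    and scale: "\<And>p a. g (sA p a) = sM [:poly p (- (snd z + snd w)):] (g a)"
  shows "g (B z w) = - g (B w z)"
proof -
  have g0: "g 0 = 0" using add[of 0 0] by simp
  have gm: "g (- a) = - g a" for a using add[of a "- a"] g0 by (simp add: add_eq_0_iff)
  have gs: "g (sum f I) = (\<Sum>i\<in>I. g (f i))" for f :: "nat \<Rightarrow> 'a" and I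
    by (induction I rule: infinite_finite_induct) (simp_all add: add g0)
  let ?p = "br (fst w) (fst z)"
  have "B z w = - (\<Sum>n\<le>degree ?p. sA ([:- snd z, - 1:] ^ n) (coeff ?p n))"
    using arg_cong[OF br_skew[of "fst z" "fst w"], of "ev sA (\<lambda>_. snd z)"]
    by (simp add: PA.ev_uminus PA.ev_at_lam B_def pev_def poly_const_pow ring.ev_diff ring.ev_uminus)
  then have "g (B z w) = - (\<Sum>n\<le>degree ?p. sM [:snd w ^ n:] (g (coeff ?p n)))"
    by (simp add: gm gs scale poly_power)
  also have "\<dots> = - g (B w z)"
    by (simp add: B_def pev_def gs scale)
  finally show ?thesis .
qed

sublocale evaluated_lca sA sM B ac
proof unfold_locales
  show "g (B z w) = - g (B w z)"
    if "\<And>a b. g (a + b) = g a + g b"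
      and "\<And>p a. g (sA p a) = sM [:poly p (- (snd z + snd w)):] (g a)" for g z w
    using that by (rule B_skew_sym[of g])
qed (rule ac_add_right ac_scale_right ac_linear_left ac_B B_linear_left B_linear_right B_B)+

text \<open>The function on lists of pairs that a cochain defines.  List positions beyond the end have
  arbitrary values, which is harmless since the variables of a \<open>q\<close>-cochain are the first \<open>q\<close>.\<close>
definition Ev :: "('a, 'm) cochain \<Rightarrow> ('a \<times> 'f) list \<Rightarrow> 'm"
  where "Ev f zs = ev sM (\<lambda>i. snd (zs ! i)) (f (map fst zs))"

abbreviation at_pt :: "'a list \<Rightarrow> (nat \<Rightarrow> 'f) \<Rightarrow> ('a \<times> 'f) list"
  where "at_pt as c \<equiv> zip as (map c [0..<length as])"

definition bounded_cochain :: "nat \<Rightarrow> ('a, 'm) cochain \<Rightarrow> bool"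
  where "bounded_cochain q f \<longleftrightarrow> (\<forall>as. length as \<noteq> q \<longrightarrow> f as = 0) \<and>
    (\<forall>as. \<forall>t\<in>Poly_Mapping.keys (f as). Poly_Mapping.keys t \<subseteq> {..<q})"

lemma bounded_keys: "bounded_cochain q f \<Longrightarrow> t \<in> Poly_Mapping.keys (f as) \<Longrightarrow> Poly_Mapping.keys t \<subseteq> {..<q}"
  and bounded_length: "bounded_cochain q f \<Longrightarrow> length as \<noteq> q \<Longrightarrow> f as = 0"
  unfolding bounded_cochain_def by blast+

lemma Ev_length: "bounded_cochain q f \<Longrightarrow> length zs \<noteq> q \<Longrightarrow> Ev f zs = 0"
  by (simp add: Ev_def bounded_length)

lemma ev_eq_Ev: "bounded_cochain q f \<Longrightarrow> ev sM c (f as) = Ev f (at_pt as c)"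
proof (cases "length as = q")
  case True
  assume f: "bounded_cochain q f"
  have "ev sM c (f as) = ev sM (\<lambda>i. snd (at_pt as c ! i)) (f as)"
    by (rule PM.ev_cong[where q = q]) (use bounded_keys[OF f] True in auto)
  then show ?thesis by (simp add: Ev_def)
qed (simp add: Ev_length bounded_length)

lemma at_pt_self: "at_pt (map fst zs) (\<lambda>i. snd (zs ! i)) = zs"
  by (rule nth_equalityI) (simp_all add: prod_eq_iff)

lemma ev_at_lams_Ev:
  assumes f: "bounded_cochain q f" and rs: "map (evr c) rs = map (\<lambda>w. [:snd w:]) ws"
  shows "ev sM c (at_lams sM rs (f (map fst ws))) = Ev f ws"
proof (cases "length ws = q")
  case True
  have "evr c (rs ! i) = [:snd (ws ! i):]" if "i < q" for i
    using arg_cong[OF rs, of "\<lambda>l. l ! i"] map_eq_imp_length_eq[OF rs] that True by simp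
  then show ?thesis
    unfolding Ev_def by (intro PM.ev_at_lams[where q = q]) (use bounded_keys[OF f] in blast)+
next
  case False
  then show ?thesis by (simp add: Ev_length[OF f] bounded_length[OF f] at_lams_def)
qed

lemma permute_list_transpose:
  "a < length zs \<Longrightarrow> b < length zs \<Longrightarrow>
    permute_list (transpose a b) zs = zs[a := zs ! b, b := zs ! a]"
  by (intro nth_equalityI) (auto simp: permute_list_def transpose_def nth_list_update)

lemma permute_transpose:
  "permute_list (transpose (length xs) (Suc (length xs + length ys))) (xs @ z # ys @ w # us)
    = xs @ w # ys @ z # us"
  by (simp add: permute_list_transpose list_update_append nth_append)

text \<open>Move \<open>z\<close> to the right across \<open>ys\<close>, swap, and move \<open>w\<close> back; the two signs from moving cancel.\<close>
lemma alt_swap_far: "alt \<phi> \<Longrightarrow> \<phi> (xs @ z # ys @ w # us) = - \<phi> (xs @ w # ys @ z # us)"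
proof (induction xs arbitrary: \<phi>)
  case Nil
  have 1: "\<phi> (ys @ v # u # us) = sM ((- 1) ^ length ys) (\<phi> (v # ys @ u # us))" for v u
    by (rule alt_move[OF Nil])
  have "sM ((- 1) ^ length ys) (\<phi> (z # ys @ w # us)) = sM ((- 1) ^ length ys) (- \<phi> (w # ys @ z # us))"
    using 1[of z w] 1[of w z] alt_swap[OF Nil, of ys z w us] by simp
  then have "sM ((- 1) ^ length ys * (- 1) ^ length ys) (\<phi> (z # ys @ w # us))
    = sM ((- 1) ^ length ys * (- 1) ^ length ys) (- \<phi> (w # ys @ z # us))"
    by (simp only: M.scale_scale[symmetric])
  then show ?case by (simp add: power_add[symmetric])
next
  case (Cons x xs)
  then show ?case using Cons.IH[OF alt_Cons[OF Cons.prems]] by simp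
qed

lemma alt_permute:
  assumes "alt \<phi>" "\<pi> permutes {..<length zs}"
  shows "\<phi> (permute_list \<pi> zs) = sM (of_int (sign \<pi>)) (\<phi> zs)"
proof -
  define n where "n = length zs"
  have tr: "\<phi> (permute_list (transpose a b) ys) = - \<phi> ys" if ab: "a < b" "b < length ys" for a b ys
  proof -
    obtain xs vs us z w where ys: "ys = xs @ z # vs @ w # us" and "a = length xs"
      and "b = Suc (length xs + length vs)"
    proof
      show "ys = take a ys @ ys ! a # take (b - Suc a) (drop (Suc a) ys) @ ys ! b # drop (Suc b) ys"
        using ab id_take_nth_drop[of a ys] id_take_nth_drop[of "b - Suc a" "drop (Suc a) ys"] by simp
    qed (use ab in simp_all)
    then show ?thesis
      using alt_swap_far[OF assms(1), of xs w vs z us] by (simp add: permute_transpose)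
  qed
  have tr': "\<phi> (permute_list (transpose a b) ys) = - \<phi> ys"
    if "a < length ys" "b < length ys" "a \<noteq> b" for a b ys
    using tr[of a b ys] tr[of b a ys] that by (cases "a < b") (auto simp: transpose_commute)
  have "\<forall>ys. length ys = n \<longrightarrow> \<phi> (permute_list \<pi> ys) = sM (of_int (sign \<pi>)) (\<phi> ys)"
    using assms(2) finite_lessThan[of n] unfolding n_def[symmetric]
  proof (induction rule: permutes_induct)
    case id
    then show ?case by (simp add: id_def[symmetric])
  next
    case (swap a b p)
    show ?case
    proof (intro allI impI)
      fix ys :: "('a \<times> 'f) list" assume ys: "length ys = n"
      have tp: "transpose a b permutes {..<n}" using swap by (intro permutes_swap_id)
      have "permute_list (transpose a b \<circ> p) ys = permute_list p (permute_list (transpose a b) ys)"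
        using tp swap ys by (intro permute_list_compose) auto
      moreover have "\<phi> (permute_list (transpose a b) ys) = sM (of_int (sign (transpose a b))) (\<phi> ys)"
        using tr'[of a ys b] swap ys by (simp add: sign_swap_id transpose_same)
      moreover have "sign (transpose a b \<circ> p) = sign (transpose a b) * sign p"
        by (intro sign_compose permutes_imp_permutation[OF finite_lessThan[of n]] tp swap)
      ultimately show "\<phi> (permute_list (transpose a b \<circ> p) ys)
          = sM (of_int (sign (transpose a b \<circ> p))) (\<phi> ys)"
        using swap ys by (simp add: mult.commute)
    qed
  qed
  then show ?thesis by (simp add: n_def)
qed

lemma ev_permute:
  assumes f: "bounded_cochain q f" and \<pi>: "\<pi> permutes {..<q}" and as: "length as = q"
  shows "ev sM c (at_lams sM (permute_list \<pi> (lams q)) (f (permute_list \<pi> as)))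
    = Ev f (permute_list \<pi> (at_pt as c))"
proof -
  have "map fst (permute_list \<pi> (at_pt as c)) = permute_list \<pi> as"
    using as \<pi> by (simp add: permute_list_map[symmetric])
  moreover have "map (evr c) (permute_list \<pi> (lams q)) = map (\<lambda>w. [:snd w:]) (permute_list \<pi> (at_pt as c))"
  proof -
    have "map (\<lambda>w. [:snd w:]) (at_pt as c) = map (evr c) (lams q)"
      using as by (intro nth_equalityI) (simp_all add: lams_def)
    then show ?thesis
      using as \<pi> by (simp add: permute_list_map[symmetric] lams_def)
  qed
  ultimately show ?thesis
    using ev_at_lams_Ev[OF f] by metis
qed

lemma cochains_Ev:
  assumes "f \<in> cochains sA sM q"
  shows "bounded_cochain q f" "mlin (Ev f)" "alt (Ev f)"
proof -
  have f0: "length as \<noteq> q \<Longrightarrow> f as = 0" for as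
    using assms by (simp add: cochains_def)
  have f: "(\<forall>t\<in>Poly_Mapping.keys (f as). Poly_Mapping.keys t \<subseteq> {..<q}) \<and>
      (\<forall>i<q. \<forall>x y. f (as[i := x + y]) = f (as[i := x]) + f (as[i := y])) \<and>
      (\<forall>i<q. \<forall>k x. f (as[i := sA [:k:] x]) = lscale sM (const [:k:]) (f (as[i := x]))) \<and>
      (\<forall>i<q. f (as[i := sA del (as ! i)]) = lscale sM (- Lam i) (f as)) \<and>
      (\<forall>\<pi>. \<pi> permutes {..<q} \<longrightarrow>
        at_lams sM (permute_list \<pi> (lams q)) (f (permute_list \<pi> as))
          = lscale sM (of_int (sign \<pi>)) (f as))" if "length as = q" for as
    using assms that unfolding cochains_def by blast
  show b: "bounded_cochain q f"
    unfolding bounded_cochain_def using f f0 by (metis empty_iff keys_zero)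
  have val: "(\<lambda>i. snd ((xs @ (a, c) # ys) ! i)) = (\<lambda>i. snd ((xs @ (0, c) # ys) ! i))"
    for xs ys :: "('a \<times> 'f) list" and a c
    by (auto simp: nth_append nth_Cons split: nat.split)
  have upd: "map fst xs @ a # map fst ys = (map fst xs @ b # map fst ys)[length xs := a]"
    for xs ys :: "('a \<times> 'f) list" and a b
    by (metis length_map list_update_length)
  show "mlin (Ev f)"
    unfolding mlin_def
  proof (intro allI conjI)
    fix xs ys c p and a b :: 'a
    show add: "Ev f (xs @ (a + b, c) # ys) = Ev f (xs @ (a, c) # ys) + Ev f (xs @ (b, c) # ys)" for a b
    proof (cases "Suc (length xs + length ys) = q")
      case True
      have "f (map fst xs @ (a + b) # map fst ys)
        = f (map fst xs @ a # map fst ys) + f (map fst xs @ b # map fst ys)"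
        using f[of "map fst xs @ 0 # map fst ys"] True
        unfolding upd[of xs "a + b" ys 0] upd[of xs a ys 0] upd[of xs b ys 0] by simp
      then show ?thesis
        unfolding Ev_def val[of xs "a + b"] val[of xs a] val[of xs b] by (simp add: PM.ev_add)
    qed (simp add: Ev_length[OF b])
    have scale: "Ev f (xs @ (sA [:k:] a, c) # ys) = sM [:k:] (Ev f (xs @ (a, c) # ys))" for k a
    proof (cases "Suc (length xs + length ys) = q")
      case True
      have "f (map fst xs @ sA [:k:] a # map fst ys)
        = lscale sM (const [:k:]) (f (map fst xs @ a # map fst ys))"
        using f[of "map fst xs @ 0 # map fst ys"] True
        unfolding upd[of xs "sA [:k:] a" ys 0] upd[of xs a ys 0] by simp
      then show ?thesis
        unfolding Ev_def val[of xs "sA [:k:] a"] val[of xs a] by (simp add: PM.ev_lscale)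
    qed (simp add: Ev_length[OF b])
    have del: "Ev f (xs @ (sA del a, c) # ys) = sM [:- c:] (Ev f (xs @ (a, c) # ys))" for a
    proof (cases "Suc (length xs + length ys) = q")
      case True
      let ?as = "map fst xs @ a # map fst ys"
      have "\<forall>i<q. f (?as[i := sA del (?as ! i)]) = lscale sM (- Lam i) (f ?as)"
        using f[of ?as] True by simp
      from this[rule_format, of "length xs"] have "f (map fst xs @ sA del a # map fst ys)
        = lscale sM (- Lam (length xs)) (f ?as)"
        using True by (simp add: nth_append list_update_append)
      then show ?thesis
        unfolding Ev_def val[of xs "sA del a"] val[of xs a]
        by (simp add: PM.ev_lscale ring.ev_uminus)
    qed (simp add: Ev_length[OF b])
    show "Ev f (xs @ (sA p a, c) # ys) = sM [:poly p (- c):] (Ev f (xs @ (a, c) # ys))"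
      unfolding pcompose_const[symmetric]
      by (rule poly_semilinear[of sA sM "\<lambda>a. Ev f (xs @ (a, c) # ys)",
            OF module_axioms M.module_axioms add scale del])
  qed
  show "alt (Ev f)"
    unfolding alt_def
  proof (intro allI)
    fix xs ys and z w :: "'a \<times> 'f"
    let ?zs = "xs @ w # z # ys" and ?\<pi> = "transpose (length xs) (Suc (length xs))"
    show "Ev f (xs @ z # w # ys) = - Ev f ?zs"
    proof (cases "Suc (Suc (length xs + length ys)) = q")
      case True
      let ?c = "\<lambda>i. snd (?zs ! i)" and ?as = "map fst ?zs"
      have p: "?\<pi> permutes {..<q}" using True by (intro permutes_swap_id) auto
      have zs: "at_pt ?as ?c = ?zs" by (rule at_pt_self)
      have len: "length ?as = q" using True by simp
      have "at_lams sM (permute_list ?\<pi> (lams q)) (f (permute_list ?\<pi> ?as))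
          = lscale sM (of_int (sign ?\<pi>)) (f ?as)"
        using f[OF len] p by blast
      from arg_cong[OF this, of "ev sM ?c"] ev_permute[OF b p len, of ?c]
      show ?thesis
        unfolding zs permute_transpose[of xs "[]", simplified] by (simp add: PM.ev_lscale ring.ev_uminus sign_swap_id Ev_def)
    qed (simp add: Ev_length[OF b])
  qed
qed

text \<open>The converse of the previous lemma: whatever polynomials have values given by a multilinear
  alternating function form a cochain, because each defining identity can be checked on values.\<close>
lemma cochainI:
  assumes len: "\<And>as. length as \<noteq> q \<Longrightarrow> F as = 0"
    and ev: "\<And>c as. length as = q \<Longrightarrow> ev sM c (F as) = \<phi> (at_pt as c)"
    and \<phi>: "mlin \<phi>" "alt \<phi>"
  shows "F \<in> cochains sA sM q"
    and "length zs = q \<Longrightarrow> Ev F zs = \<phi> zs"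
proof -
  have zip_upd: "at_pt (as[i := x]) c = take i (at_pt as c) @ (x, c i) # drop (Suc i) (at_pt as c)"
    if "i < length as" for as :: "'a list" and i x c
  proof -
    have "at_pt (as[i := x]) c = (at_pt as c)[i := (x, c i)]"
      using that by (intro nth_equalityI) (auto simp: nth_list_update)
    then show ?thesis using that by (simp add: upd_conv_take_nth_drop)
  qed
  have keys: "Poly_Mapping.keys t \<subseteq> {..<q}" if "length as = q" "t \<in> Poly_Mapping.keys (F as)" for as t
  proof (rule PM.keys_boundI[OF _ that(2)])
    fix c c' :: "nat \<Rightarrow> 'f" assume "\<And>i. i < q \<Longrightarrow> c i = c' i"
    then have eq: "map c [0..<q] = map c' [0..<q]" by simp
    have "ev sM c (F as) = \<phi> (zip as (map c [0..<q]))" for c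
      using ev that(1) by simp
    then show "ev sM c (F as) = ev sM c' (F as)" by (simp only: eq)
  qed
  have b: "bounded_cochain q F"
    unfolding bounded_cochain_def using len keys by (metis empty_iff keys_zero)
  show Ev: "Ev F zs = \<phi> zs" if "length zs = q" for zs
    using that ev[of "map fst zs" "\<lambda>i. snd (zs ! i)"] at_pt_self[of zs] by (simp add: Ev_def)
  show "F \<in> cochains sA sM q"
    unfolding cochains_def mem_Collect_eq
  proof (intro conjI allI impI ballI)
    fix as :: "'a list" assume as: "length as = q"
    have ev_upd: "ev sM c (F (as[i := x]))
      = \<phi> (take i (at_pt as c) @ (x, c i) # drop (Suc i) (at_pt as c))" if "i < q" for i x c
    proof -
      have "ev sM c (F (as[i := x])) = \<phi> (at_pt (as[i := x]) c)"
        by (rule ev) (simp add: as)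
      also have "at_pt (as[i := x]) c = take i (at_pt as c) @ (x, c i) # drop (Suc i) (at_pt as c)"
        by (rule zip_upd) (simp add: that as)
      finally show ?thesis .
    qed
    show "Poly_Mapping.keys t \<subseteq> {..<q}" if "t \<in> Poly_Mapping.keys (F as)" for t
      by (rule keys[OF as that])
    show "F (as[i := x + y]) = F (as[i := x]) + F (as[i := y])" if "i < q" for i x y
      by (intro PM.ev_eqI) (simp only: PM.ev_add ev_upd[OF that] mlin_add[OF \<phi>(1)])
    show "F (as[i := sA [:k:] x]) = lscale sM (const [:k:]) (F (as[i := x]))" if "i < q" for i k x
      by (intro PM.ev_eqI) (simp add: PM.ev_lscale ev_upd[OF that] mlin_scale[OF \<phi>(1)])
    show "F (as[i := sA del (as ! i)]) = lscale sM (- Lam i) (F as)" if "i < q" for i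
    proof (rule PM.ev_eqI)
      fix c
      show "ev sM c (F (as[i := sA del (as ! i)])) = ev sM c (lscale sM (- Lam i) (F as))"
        using ev_upd[OF that, of c "as ! i"]
        by (simp add: ev_upd[OF that] mlin_scale[OF \<phi>(1)] PM.ev_lscale ring.ev_uminus)
    qed
    show "at_lams sM (permute_list \<pi> (lams q)) (F (permute_list \<pi> as))
      = lscale sM (of_int (sign \<pi>)) (F as)" if "\<pi> permutes {..<q}" for \<pi>
      using that as
      by (intro PM.ev_eqI) (simp add: ev_permute[OF b] Ev alt_permute[OF \<phi>(2)] PM.ev_lscale ev)
  qed (rule len)
qed

lemma cochain_eqI:
  assumes "f \<in> cochains sA sM q" "g \<in> cochains sA sM q"
    and "\<And>zs. length zs = q \<Longrightarrow> Ev f zs = Ev g zs"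
  shows "f = g"
proof
  fix as
  note f = cochains_Ev(1)[OF assms(1)] and g = cochains_Ev(1)[OF assms(2)]
  show "f as = g as"
  proof (cases "length as = q")
    case True
    then show ?thesis by (intro PM.ev_eqI) (simp add: ev_eq_Ev[OF f] ev_eq_Ev[OF g] assms(3))
  qed (simp add: bounded_length[OF f] bounded_length[OF g])
qed


text \<open>On values, the linear extensions in the definition of the differential become applications of
  \<open>ac\<close> and \<open>B\<close>, and the substitution of \<open>\<lambda>\<^sub>k + \<lambda>\<^sub>l\<close> gives \<open>[z\<^sub>k, z\<^sub>l]\<close> its degree.\<close>
lemma ev_diff:
  assumes f: "f \<in> cochains sA sM q" and as: "length as = Suc q"
  shows "ev sM c (diff sA br sM act q f as) = D (Ev f) (at_pt as c)"
proof -
  note b = cochains_Ev(1)[OF f] and lin = cochains_Ev(2)[OF f] and alt = cochains_Ev(3)[OF f]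
  let ?zs = "at_pt as c"
  have zs: "map fst ?zs = as" "map (\<lambda>w. [:snd w:]) ?zs = map (evr c) (lams (Suc q))"
    using as by (simp, intro nth_equalityI) (simp_all add: lams_def del: upt_Suc)
  have nth: "as ! k = fst (?zs ! k)" "c k = snd (?zs ! k)" if "k < Suc q" for k
    using that as by (simp_all del: upt_Suc)
  have fst_nths: "nths as I = map fst (nths ?zs I)" for I
    by (simp only: nths_map[symmetric] zs(1))
  have evr_nths: "map (evr c) (nths (lams (Suc q)) I) = map (\<lambda>w. [:snd w:]) (nths ?zs I)" for I
    by (simp only: nths_map[symmetric] zs(2))
  have 1: "ev sM c (lextend sM (\<lambda>m. at_lam sM (Lam k) (act (as ! k) m))
        (at_lams sM (nths (lams (Suc q)) (- {k})) (f (nths as (- {k})))))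
      = ac (?zs ! k) (Ev f (nths ?zs (- {k})))" if k: "k < Suc q" for k
  proof -
    have "ev sM c (at_lams sM (nths (lams (Suc q)) (- {k})) (f (nths as (- {k})))) = Ev f (nths ?zs (- {k}))"
      unfolding fst_nths by (rule ev_at_lams_Ev[OF b evr_nths])
    then show ?thesis
      using nth[OF k]
      by (subst PM.ev_lextend[where G = "ac (?zs ! k)" and sX = sM])
         (simp_all add: ev_act ac_add_right ac_scale_right)
  qed
  have 2: "ev sM c (lextend sM
        (\<lambda>x. at_lams sM ((Lam k + Lam l) # nths (lams (Suc q)) (- {k, l})) (f (x # nths as (- {k, l}))))
        (at_lam sA (Lam k) (br (as ! k) (as ! l))))
      = Ev f (bracket (?zs ! k) (?zs ! l) # nths ?zs (- {k, l}))" if kl: "k < Suc q" "l < Suc q" for k l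
  proof -
    let ?G = "\<lambda>x. Ev f ((x, c k + c l) # nths ?zs (- {k, l}))"
    have "ev sM c (at_lams sM ((Lam k + Lam l) # nths (lams (Suc q)) (- {k, l})) (f (x # nths as (- {k, l}))))
      = ?G x" for x
    proof -
      have "x # nths as (- {k, l}) = map fst ((x, c k + c l) # nths ?zs (- {k, l}))"
        by (simp add: fst_nths)
      moreover have "map (evr c) ((Lam k + Lam l) # nths (lams (Suc q)) (- {k, l}))
        = map (\<lambda>w. [:snd w:]) ((x, c k + c l) # nths ?zs (- {k, l}))"
        by (simp add: evr_nths ring.ev_add)
      ultimately show ?thesis using ev_at_lams_Ev[OF b] by metis
    qed
    moreover have "?G (x + y) = ?G x + ?G y" "?G (sA [:k':] x) = sM [:k':] (?G x)" for x y k'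
      by (simp_all add: mlin_add_Cons[OF lin] mlin_scale_Cons[OF lin])
    ultimately have "ev sM c (lextend sM
        (\<lambda>x. at_lams sM ((Lam k + Lam l) # nths (lams (Suc q)) (- {k, l})) (f (x # nths as (- {k, l}))))
        (at_lam sA (Lam k) (br (as ! k) (as ! l))))
      = ?G (ev sA c (at_lam sA (Lam k) (br (as ! k) (as ! l))))"
      by (rule PM.ev_lextend)
    also have "ev sA c (at_lam sA (Lam k) (br (as ! k) (as ! l))) = B (?zs ! k) (?zs ! l)"
      using nth[OF kl(1)] nth[OF kl(2)] by (simp add: PA.ev_at_lam_const B_def)
    finally show ?thesis using nth[OF kl(1)] nth[OF kl(2)] by (simp add: bracket_def)
  qed
  have sign: "evr c ((- 1) ^ k) = (- 1) ^ k" for k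
    by (simp add: evr_power ring.ev_uminus)
  have len: "length ?zs = Suc q" using as by simp
  have "ev sM c (diff sA br sM act q f as)
    = (\<Sum>k<Suc q. sM ((- 1) ^ k) (ev sM c (lextend sM (\<lambda>m. at_lam sM (Lam k) (act (as ! k) m))
        (at_lams sM (nths (lams (Suc q)) (- {k})) (f (nths as (- {k})))))))
    + (\<Sum>l<Suc q. \<Sum>k<l. sM ((- 1) ^ (k + l)) (ev sM c (lextend sM
        (\<lambda>x. at_lams sM ((Lam k + Lam l) # nths (lams (Suc q)) (- {k, l})) (f (x # nths as (- {k, l}))))
        (at_lam sA (Lam k) (br (as ! k) (as ! l))))))"
    using as by (simp only: diff_def PM.ev_add PM.ev_sum PM.ev_lscale sign simp_thms if_False)
  also have "\<dots> = diff_formula (Ev f) ?zs"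
    unfolding diff_formula_def len
    by (intro arg_cong2[where f = "(+)"] sum.cong refl arg_cong[where f = "sM _"] 1 2) auto
  finally have "ev sM c (diff sA br sM act q f as) = diff_formula (Ev f) ?zs" .
  then show ?thesis by (simp add: diff_formula_eq_D[OF alt])
qed

lemma
  assumes f: "f \<in> cochains sA sM q"
  shows diff_cochain: "diff sA br sM act q f \<in> cochains sA sM (Suc q)"
    and Ev_diff: "Ev (diff sA br sM act q f) = D (Ev f)"
proof -
  note c = cochains_Ev[OF f]
  have 0: "length as \<noteq> Suc q \<Longrightarrow> diff sA br sM act q f as = 0" for as by (simp add: diff_def)
  note I = cochainI[OF 0 ev_diff[OF f] mlin_D[OF c(2)] alt_D[OF c(2,3)]]
  show m: "diff sA br sM act q f \<in> cochains sA sM (Suc q)" by (rule I(1))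
  show "Ev (diff sA br sM act q f) = D (Ev f)"
  proof
    fix zs
    show "Ev (diff sA br sM act q f) zs = D (Ev f) zs"
      using I(2)[where zs = zs] D_support[of q "Ev f" zs, OF Ev_length[OF c(1)]] Ev_length[OF cochains_Ev(1)[OF m]]
      by (cases "length zs = Suc q") auto
  qed
qed

definition cscale :: "'f \<Rightarrow> ('a, 'm) cochain \<Rightarrow> ('a, 'm) cochain"
  where "cscale k f as = lscale sM (const [:k:]) (f as)"

lemma ev_cscale: "ev sM c (cscale k f as) = sM [:k:] (ev sM c (f as))"
  by (simp add: cscale_def PM.ev_lscale)

sublocale cochain: vector_space cscale
  by unfold_locales
    (auto simp: fun_eq_iff ev_cscale PM.ev_add M.scale_right_distrib M.scale_left_distrib[symmetric]
       mult.commute one_pCons[symmetric] intro!: PM.ev_eqI)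

lemma Ev_add: "Ev (f + g) = (\<lambda>zs. Ev f zs + Ev g zs)"
  and Ev_scale: "Ev (cscale k f) = (\<lambda>zs. sM [:k:] (Ev f zs))"
  and Ev_0: "Ev 0 = (\<lambda>zs. 0)"
  by (simp_all add: fun_eq_iff Ev_def PM.ev_add ev_cscale)

lemma subspace_cochains: "cochain.subspace (cochains sA sM q)"
proof (rule cochain.subspaceI)
  show "0 \<in> cochains sA sM q"
    by (rule cochainI(1)[where \<phi> = "\<lambda>_. 0"]) (simp_all add: mlin_def alt_def)
  fix f g k assume f: "f \<in> cochains sA sM q"
  note f' = cochains_Ev[OF f]
  show "cscale k f \<in> cochains sA sM q"
  proof (rule cochainI(1)[where \<phi> = "\<lambda>zs. sM [:k:] (Ev f zs)"])
    show "cscale k f as = 0" if "length as \<noteq> q" for as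
      using that by (simp add: cscale_def bounded_length[OF f'(1)] lscale_def)
    show "mlin (\<lambda>zs. sM [:k:] (Ev f zs))" "alt (\<lambda>zs. sM [:k:] (Ev f zs))"
      by (rule mlin_const_scale[OF f'(2)], rule alt_const_scale[OF f'(3)])
  qed (simp add: ev_cscale ev_eq_Ev[OF f'(1)])
  assume g: "g \<in> cochains sA sM q"
  note g' = cochains_Ev[OF g]
  show "f + g \<in> cochains sA sM q"
  proof (rule cochainI(1)[where \<phi> = "\<lambda>zs. Ev f zs + Ev g zs"])
    show "(f + g) as = 0" if "length as \<noteq> q" for as
      using that by (simp add: bounded_length[OF f'(1)] bounded_length[OF g'(1)])
    show "mlin (\<lambda>zs. Ev f zs + Ev g zs)"
      using f'(2) g'(2) by (rule mlin_plus)
    show "alt (\<lambda>zs. Ev f zs + Ev g zs)"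
      using f'(3) g'(3) by (rule alt_plus)
  qed (simp add: PM.ev_add ev_eq_Ev[OF f'(1)] ev_eq_Ev[OF g'(1)])
qed

end

section \<open>The contraction with the Virasoro element\<close>

locale conformal_lca_module = lca_module_char_0 sA br sM act
  for sA :: "'f::field_char_0 poly \<Rightarrow> 'a::ab_group_add \<Rightarrow> 'a"
    and br :: "'a \<Rightarrow> 'a \<Rightarrow> 'a poly"
    and sM :: "'f poly \<Rightarrow> 'm::ab_group_add \<Rightarrow> 'm"
    and act :: "'a \<Rightarrow> 'm \<Rightarrow> 'm poly" +
  fixes L :: 'a
  assumes br_L: "coeff (br L a) 0 = sA del a"
    and act_L: "coeff (act L m) 0 = sM del m"
    and free_M: "is_free sM"
begin

lemma theta_L: "mlin \<phi> \<Longrightarrow> theta (L, 0) \<phi> zs = sM (del + [:sum_list (map snd zs):]) (\<phi> zs)"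
proof (rule theta_virasoro)
  show "ac (L, 0) m = sM del m" for m
    by (simp add: ac_def PM.pev_0 act_L)
  show "B (L, 0) (a, c) = sA del a" for a c
    by (simp add: B_def PA.pev_0 br_L)
qed simp_all

lemma ev_del_cochain:
  assumes f: "f \<in> cochains sA sM q"
  shows "ev sM c (del_cochain sM q f as) = theta (L, 0) (Ev f) (at_pt as c)"
proof (cases "length as = q")
  case True
  have "sum_list (map snd (at_pt as c)) = (\<Sum>k<q. c k)"
    using True by (simp add: interv_sum_list_conv_sum_set_nat atLeast0LessThan)
  moreover have "evr c (Del + (\<Sum>k<q. Lam k)) = del + [:\<Sum>k<q. c k:]"
    by (simp add: ring.ev_add ring.ev_sum sum_to_poly)
  ultimately show ?thesis
    unfolding theta_L[OF cochains_Ev(2)[OF f]] del_cochain_def PM.ev_lscale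
    by (simp add: ev_eq_Ev[OF cochains_Ev(1)[OF f]])
next
  case False
  then show ?thesis
    using theta_support[of q "Ev f" "at_pt as c", OF Ev_length[OF cochains_Ev(1)[OF f]]]
    by (simp add: del_cochain_def bounded_length[OF cochains_Ev(1)[OF f]] lscale_def)
qed

lemma
  assumes f: "f \<in> cochains sA sM q"
  shows del_cochain: "del_cochain sM q f \<in> cochains sA sM q"
    and Ev_del: "length zs = q \<Longrightarrow> Ev (del_cochain sM q f) zs = theta (L, 0) (Ev f) zs"
proof -
  note c = cochains_Ev[OF f]
  have 0: "length as \<noteq> q \<Longrightarrow> del_cochain sM q f as = 0" for as
    by (simp add: del_cochain_def bounded_length[OF c(1)] lscale_def)
  note I = cochainI[OF 0 ev_del_cochain[OF f] mlin_theta[OF c(2)] alt_theta[OF c(3)]]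
  show "del_cochain sM q f \<in> cochains sA sM q" by (rule I(1))
  show "length zs = q \<Longrightarrow> Ev (del_cochain sM q f) zs = theta (L, 0) (Ev f) zs" by (rule I(2))
qed

lemma Ev_del_cochain: 
  assumes f: "f \<in> cochains sA sM q"
  shows "Ev (del_cochain sM q f) = theta (L, 0) (Ev f)"
proof
  fix zs
  show "Ev (del_cochain sM q f) zs = theta (L, 0) (Ev f) zs"
    using Ev_del[OF f, of zs] Ev_length[OF cochains_Ev(1)[OF del_cochain[OF f]], of zs]
      theta_support[of q "Ev f" zs, OF Ev_length[OF cochains_Ev(1)[OF f]]]
    by (cases "length zs = q") auto
qed

text \<open>Contraction with \<open>L\<close> at \<open>\<lambda> = 0\<close>.\<close>
definition contract_L :: "nat \<Rightarrow> ('a, 'm) cochain \<Rightarrow> ('a, 'm) cochain"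
  where "contract_L q f as = (if length as = q then at_lams sM (0 # lams q) (f (L # as)) else 0)"

lemma
  assumes f: "f \<in> cochains sA sM (Suc q)"
  shows contract_L_cochain: "contract_L q f \<in> cochains sA sM q"
    and Ev_contract_L: "Ev (contract_L q f) = (\<lambda>zs. Ev f ((L, 0) # zs))"
proof -
  note c = cochains_Ev[OF f]
  have 0: "length as \<noteq> q \<Longrightarrow> contract_L q f as = 0" for as by (simp add: contract_L_def)
  have ev: "ev sM c (contract_L q f as) = Ev f ((L, 0) # at_pt as c)" if as: "length as = q" for c as
  proof -
    have "L # as = map fst ((L, 0) # at_pt as c)" by simp
    moreover have "map (evr c) (0 # lams q) = map (\<lambda>w. [:snd w:]) ((L, 0) # at_pt as c)"
      using as by (simp, intro nth_equalityI) (simp_all add: lams_def)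
    ultimately show ?thesis
      using as ev_at_lams_Ev[OF c(1)] by (metis contract_L_def)
  qed
  note I = cochainI[OF 0 ev mlin_Cons[OF c(2)] alt_Cons[OF c(3)]]
  show m: "contract_L q f \<in> cochains sA sM q" by (rule I(1))
  show "Ev (contract_L q f) = (\<lambda>zs. Ev f ((L, 0) # zs))"
  proof
    fix zs
    show "Ev (contract_L q f) zs = Ev f ((L, 0) # zs)"
      using I(2)[where zs = zs] Ev_length[OF cochains_Ev(1)[OF m], of zs] Ev_length[OF c(1), of "(L, 0) # zs"]
      by (cases "length zs = q") auto
  qed
qed

text \<open>Every identity is checked after evaluation.  The homotopy formula is then Cartan's formula for
  \<open>(L, 0)\<close>, that is, the recursive equation of the differential.\<close>
lemma null_homotopic_cochains: "null_homotopic_complex cscale (cochains sA sM)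
  (diff sA br sM act) (del_cochain sM) contract_L"
proof (intro null_homotopic_complex.intro null_homotopic_complex_axioms.intro cochain.vector_space_axioms)
  fix q and x y :: "('a, 'm) cochain" and k :: 'f
  let ?C = "cochains sA sM"
  let ?d = "diff sA br sM act"
  note add = cochain.subspace_add[OF subspace_cochains] and scale = cochain.subspace_scale[OF subspace_cochains]
  show "cochain.subspace (?C q)" by (rule subspace_cochains)
  {
    assume x: "x \<in> ?C q"
    note dx = diff_cochain[OF x] and ex = del_cochain[OF x] and lin = cochains_Ev(2)[OF x]
    show "?d q x \<in> ?C (Suc q)" by (rule dx)
    show "del_cochain sM q x \<in> ?C q" by (rule ex)
    show "?d q (cscale k x) = cscale k (?d q x)"
      by (rule cochain_eqI[OF diff_cochain[OF scale[OF x]] scale[OF dx]])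
         (simp add: Ev_diff x scale[OF x] Ev_scale D_scale)
    show "?d (Suc q) (?d q x) = 0"
      by (rule cochain_eqI[OF diff_cochain[OF dx] cochain.subspace_0[OF subspace_cochains]])
         (simp add: Ev_diff x dx Ev_0 D_D lin)
    show "del_cochain sM q (cscale k x) = cscale k (del_cochain sM q x)"
      by (rule cochain_eqI[OF del_cochain[OF scale[OF x]] scale[OF ex]])
         (simp add: Ev_del_cochain x scale[OF x] Ev_scale theta_scale)
    show "x = 0" if 0: "del_cochain sM q x = 0"
    proof (rule cochain_eqI[OF x cochain.subspace_0[OF subspace_cochains]])
      fix zs
      have "sM (del + [:sum_list (map snd zs):]) (Ev x zs) = 0"
        using fun_cong[OF Ev_del_cochain[OF x], of zs] unfolding 0 theta_L[OF lin] by (simp add: Ev_0)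
      from PM.torsion_free[OF free_M this] show "Ev x zs = Ev 0 zs"
        by (simp add: Ev_0)
    qed
    show "?d q (del_cochain sM q x) = del_cochain sM (Suc q) (?d q x)"
      by (rule cochain_eqI[OF diff_cochain[OF ex] del_cochain[OF dx]])
         (simp add: Ev_del_cochain Ev_diff x dx ex theta_D_commute lin)
    assume y: "y \<in> ?C q"
    note dy = diff_cochain[OF y] and ey = del_cochain[OF y]
    show "?d q (x + y) = ?d q x + ?d q y"
      by (rule cochain_eqI[OF diff_cochain[OF add[OF x y]] add[OF dx dy]])
         (simp add: Ev_diff x y add[OF x y] Ev_add D_add)
    show "del_cochain sM q (x + y) = del_cochain sM q x + del_cochain sM q y"
      by (rule cochain_eqI[OF del_cochain[OF add[OF x y]] add[OF ex ey]])
         (simp add: Ev_del_cochain x y add[OF x y] Ev_add theta_add)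
  }
  {
    assume x: "x \<in> ?C (Suc q)"
    note hx = contract_L_cochain[OF x]
    show "contract_L q x \<in> ?C q" by (rule hx)
    show "contract_L q (cscale k x) = cscale k (contract_L q x)"
      by (rule cochain_eqI[OF contract_L_cochain[OF scale[OF x]] scale[OF hx]])
         (simp add: Ev_contract_L x scale[OF x] Ev_scale)
    show "?d q (contract_L q x) + contract_L (Suc q) (?d (Suc q) x) = del_cochain sM (Suc q) x"
      by (rule cochain_eqI[OF add[OF diff_cochain[OF hx] contract_L_cochain[OF diff_cochain[OF x]]]
            del_cochain[OF x]])
         (simp add: Ev_add Ev_del_cochain Ev_diff Ev_contract_L x hx diff_cochain[OF x])
    assume y: "y \<in> ?C (Suc q)"
    show "contract_L q (x + y) = contract_L q x + contract_L q y"
      by (rule cochain_eqI[OF contract_L_cochain[OF add[OF x y]] add[OF hx contract_L_cochain[OF y]]])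
         (simp add: Ev_contract_L x y add[OF x y] Ev_add)
  }
qed

lemma basic_space_eq: "basic_space sA sM q = subspace_record cscale (cochains sA sM q)"
  by (simp add: basic_space_def subspace_record_def fun_eq_iff cscale_def)

lemma vdim_reduced_cohomology:
  "vdim (reduced_cohomology sA br sM act (Suc p)) =o
    vdim (basic_cohomology sA br sM act (Suc p)) +c vdim (basic_cohomology sA br sM act (Suc (Suc p)))"
  using null_homotopic_complex.vdim_reduced[OF null_homotopic_cochains, of p]
  by (simp add: reduced_cohomology_def basic_cohomology_def reduced_space_def[abs_def]
      reduced_diff_def[abs_def] del_image_def basic_space_eq[abs_def])

end

theorem mainTheorem2:
  fixes sA :: "'f::field_char_0 poly \<Rightarrow> 'a::ab_group_add \<Rightarrow> 'a"
    and br :: "'a \<Rightarrow> 'a \<Rightarrow> 'a poly"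
    and sM :: "'f poly \<Rightarrow> 'm::ab_group_add \<Rightarrow> 'm"
    and act :: "'a \<Rightarrow> 'm \<Rightarrow> 'm poly"
    and L :: 'a
    and q :: nat
  assumes "lie_conformal_algebra sA br"
    and "is_free sA"
    and "virasoro_element sA br L"
    and "has_eigenbasis sA (\<lambda>a. coeff (br L a) 1)"
    and "lca_module sA br sM act"
    and "is_free sM"
    and "conformal_module sM act L"
    and "has_eigenbasis sM (\<lambda>m. coeff (act L m) 1)"
    and "q \<ge> 1"
  shows "vdim (reduced_cohomology sA br sM act q)
    =o vdim (basic_cohomology sA br sM act q) +c vdim (basic_cohomology sA br sM act (q + 1))"
proof -
  interpret lca_module sA br sM act by fact
  interpret conformal_lca_module sA br sM act L
    using assms(3,6,7) by unfold_locales (auto simp: virasoro_element_def conformal_module_def)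
  obtain p where "q = Suc p" using assms(9) by (cases q) auto
  then show ?thesis using vdim_reduced_cohomology[of p] by simp
qed

end
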